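(* Let $\rho\in[1,\infty]$, $R\ge1$, let $\boldsymbol{f}=(f_1,\dots,f_R)\in(L^{\rho}(\mathcal{O}_{\mathbb{K}}))^{R}$ with $\|\boldsymbol{f}\|_{\rho}<M$, and let $\epsilon>0$. Then for any $\boldsymbol{L}=(L_1,\dots,L_R)$ with $L_i\ge 1$ for all $i$, and any input $\boldsymbol{X}\in\bigoplus_{i=1}^{R}\mathcal{D}^{L_i}(\mathcal{O}_{\mathbb{K}})$, there exists a network $DNN(\mathcal{O}_{\mathbb{K}},\boldsymbol{\sigma},R,\boldsymbol{L},\boldsymbol{\Delta},\boldsymbol{w},\boldsymbol{\theta})$, with $\boldsymbol{\sigma}=(\sigma_{M_1},\dots,\sigma_{M_R})$ for some $M_1,\dots,M_R$, such that the output $\boldsymbol{Y}\in\bigoplus_{i=1}^{R}\mathcal{D}^{L_i+\Delta_i}(\mathcal{O}_{\mathbb{K}})$ satisfies $$\|\boldsymbol{Y}-\boldsymbol{f}\|_{\rho}<\epsilon$$ for any $\boldsymbol{w}$ in a ball (of positive radius) in $\bigoplus_{i=1}^{R}\mathcal{D}^{L_i+\Delta_i}(\mathcal{O}_{\mathbb{K}}\times\mathcal{O}_{\mathbb{K}})$ and any $\boldsymbol{\theta}$ in a ball (of positive radius) in $\bigoplus_{i=1}^{R}\mathcal{D}^{L_i+\Delta_i}(\mathcal{O}_{\mathbb{K}})$.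
   Context: Let $p$ be a prime and let $\mathbb{K}$ be $\mathbb{Q}_p$ (with $\wp=p$) or $\mathbb{F}_p((T))$ (with $\wp=T$), with ring of integers $\mathcal{O}_{\mathbb{K}}$ and Haar measure normalized by $\int_{\mathcal{O}_{\mathbb{K}}}dx=1$. $L^\rho(\mathcal{O}_{\mathbb{K}})$ is the real-valued $L^\rho$ space with norm $\|\cdot\|_\rho$; on $(L^\rho(\mathcal{O}_{\mathbb{K}}))^R$ set $\|\boldsymbol{f}\|_\rho=\max_{1\le i\le R}\|f_i\|_\rho$. For $l\ge1$, $G_l=\mathcal{O}_{\mathbb{K}}/\wp^l\mathcal{O}_{\mathbb{K}}$, identified with the representatives $i_0+i_1\wp+\dots+i_{l-1}\wp^{l-1}$, $i_j\in\{0,\dots,p-1\}$. $\mathcal{D}^l(\mathcal{O}_{\mathbb{K}})\simeq\mathbb{R}^{p^l}$ (sup norm) is the real vector space of functions on $\mathcal{O}_{\mathbb{K}}$ constant on each ball $\boldsymbol{i}+\wp^l\mathcal{O}_{\mathbb{K}}$, $\boldsymbol{i}\in G_l$. $\mathcal{D}^l(\mathcal{O}_{\mathbb{K}}\times\mathcal{O}_{\mathbb{K}})\simeq\mathbb{R}^{p^{2l}}$ (sup norm) is the space of real functions constant on the products $(\boldsymbol{i}+\wp^l\mathcal{O}_{\mathbb{K}})\times(\boldsymbol{k}+\wp^l\mathcal{O}_{\mathbb{K}})$. Direct sums carry the maximum of the sup norms. For $l\ge 2$, $\Lambda_l:G_l\to G_{l-1}$ is the natural homomorphism (drop the coefficient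 of $\wp^{l-1}$). Fix an activation function $\sigma:\mathbb{R}\to(-1,1)$, surjective and differentiable; for $M>1$ set $\sigma_M=M\sigma:\mathbb{R}\to(-M,M)$. Given positive integers $L,\Delta$, $\theta\in\mathcal{D}^{L+\Delta}(\mathcal{O}_{\mathbb{K}})$ and $w\in\mathcal{D}^{L+\Delta}(\mathcal{O}_{\mathbb{K}}\times\mathcal{O}_{\mathbb{K}})$, the network $DNN(\mathcal{O}_{\mathbb{K}},\sigma_M,L,\Delta,w,\theta)$ takes an input $X^{(L)}\in\mathcal{D}^L(\mathcal{O}_{\mathbb{K}})$, has states $$X^{(l)}(\boldsymbol{j})=\sigma_M\Big(\sum_{\boldsymbol{k}\in G_l}w(\boldsymbol{j},\boldsymbol{k})X^{(l-1)}(\Lambda_l(\boldsymbol{k}))+\theta(\boldsymbol{j})\Big),\quad \boldsymbol{j}\in G_l,\ l=L+1,\dots,L+\Delta,$$ and has output the function $Y\in\mathcal{D}^{L+\Delta}(\mathcal{O}_{\mathbb{K}})$ with $Y(\boldsymbol{j})=X^{(L+\Delta)}(\boldsymbol{j})$, $\boldsymbol{j}\in G_{L+\Delta}$. $DNN(\mathcal{O}_{\mathbb{K}},\boldsymbol{\sigma},R,\boldsymbol{L},\boldsymbol{\Delta},\boldsymbol{w},\boldsymbol{\theta})$, with $\boldsymbol{\sigma}=(\sigma_{M_i})_i$, $\boldsymbol{L}=(L_i)_i$, $\boldsymbol{\Delta}=(\Delta_i)_i$ (positive integers), $\boldsymbol{w}=(w_i)_i$, $\boldsymbol{\theta}=(\theta_i)_i$,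 is the direct product of the networks $DNN(\mathcal{O}_{\mathbb{K}},\sigma_{M_i},L_i,\Delta_i,w_i,\theta_i)$, $i=1,\dots,R$: its input is $\boldsymbol{X}=(X_1,\dots,X_R)$ and its output is $\boldsymbol{Y}=(Y_1,\dots,Y_R)$, where $Y_i$ is the output of the $i$-th network with input $X_i$. The number $M>1$ in the claim is arbitrary with $\|\boldsymbol{f}\|_\rho<M$.
   Formalization: For ρ = ∞ the claim fails for general essentially bounded f, since locally constant functions are not dense in L^∞; the formal theorem assumes in that case that each f_i agrees almost everywhere with a continuous function. *)

theory Defs
  imports
    "HOL-Probability.Probability"
    "HOL-Computational_Algebra.Formal_Power_Series"
    "Berlekamp_Zassenhaus.Finite_Field"
begin

section \<open>The ring of integers of the field of p-adic numbers\<close>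

text \<open>
  The prime is \<open>p = CARD('p)\<close>.  The p-adic integers, i.e. the ring of integers of the field of
  p-adic numbers, are the inverse limit of the rings of integers modulo \<open>p ^ n\<close>: the \<open>n\<close>-th
  component of an element is its residue in \<open>{0..<p ^ n}\<close>.
\<close>

typedef (overloaded) ('p :: prime_card) padic_int =
  "{x :: nat \<Rightarrow> int. \<forall>n. x n \<in> {0..<int CARD('p) ^ n} \<and> x (Suc n) mod int CARD('p) ^ n = x n}"
  by (rule exI[of _ "\<lambda>_. 0"]) (simp add: zero_less_card_finite)

setup_lifting type_definition_padic_int

lemma card_prime_card_gt_1: "1 < int CARD('p :: prime_card)"
  using prime_gt_1_nat[OF prime_card[where 'a = 'p]] by simp

lemma mod_power_Suc_mod_power: "a mod (q :: int) ^ Suc n mod q ^ n = a mod q ^ n"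
  by (rule mod_mod_cancel) simp

instantiation padic_int :: (prime_card) comm_ring_1
begin

lift_definition zero_padic_int :: "'a padic_int" is "\<lambda>_. 0"
  by (simp add: zero_less_card_finite)

lift_definition one_padic_int :: "'a padic_int" is "\<lambda>n. 1 mod int CARD('a) ^ n"
  by (simp add: zero_less_card_finite mod_power_Suc_mod_power del: power_Suc)

lift_definition plus_padic_int :: "'a padic_int \<Rightarrow> 'a padic_int \<Rightarrow> 'a padic_int"
  is "\<lambda>x y n. (x n + y n) mod int CARD('a) ^ n"
  by (simp add: zero_less_card_finite mod_power_Suc_mod_power del: power_Suc) (metis mod_add_eq)

lift_definition minus_padic_int :: "'a padic_int \<Rightarrow> 'a padic_int \<Rightarrow> 'a padic_int"
  is "\<lambda>x y n. (x n - y n) mod int CARD('a) ^ n"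
  by (simp add: zero_less_card_finite mod_power_Suc_mod_power del: power_Suc) (metis mod_diff_eq)

lift_definition uminus_padic_int :: "'a padic_int \<Rightarrow> 'a padic_int"
  is "\<lambda>x n. (- x n) mod int CARD('a) ^ n"
  by (simp add: zero_less_card_finite mod_power_Suc_mod_power del: power_Suc) (metis mod_minus_eq)

lift_definition times_padic_int :: "'a padic_int \<Rightarrow> 'a padic_int \<Rightarrow> 'a padic_int"
  is "\<lambda>x y n. (x n * y n) mod int CARD('a) ^ n"
  by (simp add: zero_less_card_finite mod_power_Suc_mod_power del: power_Suc) (metis mod_mult_eq)

instance
proof
  fix a b c :: "'a padic_int"
  show "a * b * c = a * (b * c)"
    by transfer (simp add: fun_eq_iff mod_simps mult.assoc)
  show "a * b = b * a"
    by transfer (simp add: fun_eq_iff mult.commute)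
  show "1 * a = a"
    by transfer (simp add: fun_eq_iff mod_simps)
  show "a + b + c = a + (b + c)"
    by transfer (simp add: fun_eq_iff mod_simps add.assoc)
  show "a + b = b + a"
    by transfer (simp add: fun_eq_iff add.commute)
  show "0 + a = a"
    by transfer (simp add: fun_eq_iff)
  show "- a + a = 0"
    by transfer (simp add: fun_eq_iff mod_simps)
  show "a - b = a + - b"
    by transfer (simp add: fun_eq_iff mod_simps)
  show "(a + b) * c = a * c + b * c"
    by transfer (simp add: fun_eq_iff mod_simps distrib_right)
  show "(0 :: 'a padic_int) \<noteq> 1"
    using card_prime_card_gt_1[where 'p = 'a] by transfer (auto simp: fun_eq_iff intro!: exI[of _ 1])
qed

end

text \<open>
  The metric is \<open>\<bar>x - y\<bar>\<^sub>p = p powi (- v)\<close>, where \<open>v\<close> is the largest number such that \<open>x\<close> and \<open>y\<close>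
  agree modulo \<open>p ^ v\<close>; equivalently \<open>v\<close> is least such that they differ modulo \<open>p ^ (v + 1)\<close>.
\<close>

definition padic_agree :: "('p :: prime_card) padic_int \<Rightarrow> 'p padic_int \<Rightarrow> nat" where
  "padic_agree x y = (LEAST n. Rep_padic_int x (Suc n) \<noteq> Rep_padic_int y (Suc n))"

lemma padic_agree_neq:
  assumes "x \<noteq> y"
  shows "Rep_padic_int x (Suc (padic_agree x y)) \<noteq> Rep_padic_int y (Suc (padic_agree x y))"
proof -
  have zero: "Rep_padic_int z 0 = 0" for z :: "'a padic_int"
    using Rep_padic_int[of z] by (auto dest: spec[of _ 0])
  obtain m where "Rep_padic_int x m \<noteq> Rep_padic_int y m"
    using assms by (auto simp: Rep_padic_int_inject[symmetric] fun_eq_iff)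
  with zero obtain n where "Rep_padic_int x (Suc n) \<noteq> Rep_padic_int y (Suc n)"
    by (cases m) auto
  then show ?thesis
    unfolding padic_agree_def by (rule LeastI)
qed

lemma padic_agree_eq: "n < padic_agree x y \<Longrightarrow> Rep_padic_int x (Suc n) = Rep_padic_int y (Suc n)"
  unfolding padic_agree_def by (auto dest: not_less_Least)

instantiation padic_int :: (prime_card) metric_space
begin

definition dist_padic_int :: "'a padic_int \<Rightarrow> 'a padic_int \<Rightarrow> real" where
  "dist_padic_int x y = (if x = y then 0 else inverse (real CARD('a) ^ padic_agree x y))"

definition uniformity_padic_int :: "('a padic_int \<times> 'a padic_int) filter" where
  "uniformity_padic_int = (INF e\<in>{0<..}. principal {(x, y). dist x y < e})"

definition open_padic_int :: "'a padic_int set \<Rightarrow> bool" where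
  "open_padic_int U \<longleftrightarrow> (\<forall>x\<in>U. eventually (\<lambda>(x', y). x' = x \<longrightarrow> y \<in> U) uniformity)"

instance
proof
  fix x y z :: "'a padic_int"
  let ?p = "real CARD('a)"
  have p: "1 < ?p"
    using card_prime_card_gt_1[where 'p = 'a] by simp
  show "dist x y = 0 \<longleftrightarrow> x = y"
    using p by (simp add: dist_padic_int_def)
  have nonneg: "0 \<le> dist u v" for u v :: "'a padic_int"
    by (simp add: dist_padic_int_def)
  have sym: "padic_agree u v = padic_agree v u" for u v :: "'a padic_int"
    unfolding padic_agree_def by metis
  have antimono: "inverse (?p ^ m) \<le> inverse (?p ^ n)" if "n \<le> m" for m n
    using p that by (intro le_imp_inverse_le power_increasing) auto
  consider "x = y" | "x = z" | "y = z" | "x \<noteq> y" "x \<noteq> z" "y \<noteq> z"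
    by blast
  then show "dist x y \<le> dist x z + dist y z"
  proof cases
    case 4
    have "padic_agree x z \<le> padic_agree x y \<or> padic_agree y z \<le> padic_agree x y"
      using padic_agree_neq[OF 4(1)] padic_agree_eq[of "padic_agree x y" x z]
        padic_agree_eq[of "padic_agree x y" y z] by force
    then have "dist x y \<le> dist x z \<or> dist x y \<le> dist y z"
      using 4 antimono by (auto simp: dist_padic_int_def)
    then show ?thesis
      using nonneg[of x z] nonneg[of y z] by linarith
  qed (auto simp: nonneg dist_padic_int_def sym)
qed (rule open_padic_int_def uniformity_padic_int_def)+

end

section \<open>Haar measure and the Lebesgue spaces\<close>

text \<open>
  On a compact metrizable group every translation-invariant Borel probability measure is
  automatically regular, and it is the unique Haar measure of total mass one.
\<close>

definition normalized_haar :: "'a :: {ab_group_add, topological_space} measure \<Rightarrow> bool" where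
  "normalized_haar \<mu> \<longleftrightarrow>
     sets \<mu> = sets borel \<and>
     (\<forall>a. \<forall>A\<in>sets \<mu>. emeasure \<mu> ((+) a ` A) = emeasure \<mu> A) \<and>
     emeasure \<mu> UNIV = 1"

text \<open>The norm is extended-valued, so that it is \<open>\<infinity>\<close> outside the Lebesgue space.\<close>

definition Lp_norm :: "ennreal \<Rightarrow> 'a measure \<Rightarrow> ('a \<Rightarrow> real) \<Rightarrow> ennreal" where
  "Lp_norm \<rho> \<mu> f =
     (if \<rho> = \<infinity> then esssup \<mu> (\<lambda>x. ennreal \<bar>f x\<bar>)
      else let I = \<integral>\<^sup>+ x. ennreal (\<bar>f x\<bar> powr enn2real \<rho>) \<partial>\<mu>
           in if I = \<infinity> then \<infinity> else ennreal (enn2real I powr (1 / enn2real \<rho>)))"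

definition Lp_space :: "ennreal \<Rightarrow> 'a measure \<Rightarrow> ('a \<Rightarrow> real) set" where
  "Lp_space \<rho> \<mu> = {f \<in> borel_measurable \<mu>. Lp_norm \<rho> \<mu> f < \<infinity>}"

text \<open>
  For \<open>\<rho> = \<infinity>\<close> the locally constant functions are not dense: their closure consists of the functions
  that agree almost everywhere with a continuous function.  An approximation statement by
  locally constant functions therefore needs this restriction when \<open>\<rho> = \<infinity>\<close>, and only then.
\<close>

text \<open>Here and below, \<open>R\<close>-tuples are functions on \<open>nat\<close> of which only the values on \<open>{1..R}\<close> matter.\<close>

definition Lp_norm_tuple :: "nat \<Rightarrow> ennreal \<Rightarrow> 'a measure \<Rightarrow> (nat \<Rightarrow> 'a \<Rightarrow> real) \<Rightarrow> ennreal" where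
  "Lp_norm_tuple R \<rho> \<mu> f = (MAX i\<in>{1..R}. Lp_norm \<rho> \<mu> (f i))"

section \<open>Locally constant functions\<close>

text \<open>
  In this section and the next, the type \<open>'a\<close> is the whole ring of integers, \<open>\<pi>\<close> is the chosen
  uniformizer and \<open>p\<close> is the number of elements of the residue field.
\<close>

definition digit_sums :: "nat \<Rightarrow> 'a :: comm_ring_1 \<Rightarrow> nat \<Rightarrow> 'a set" where
  "digit_sums p \<pi> l = {\<Sum>j<l. of_nat (d j) * \<pi> ^ j |d. \<forall>j<l. d j < p}"

definition adic_ball :: "'a :: comm_ring_1 \<Rightarrow> nat \<Rightarrow> 'a \<Rightarrow> 'a set" where
  "adic_ball \<pi> l a = range (\<lambda>y. a + \<pi> ^ l * y)"

definition lc_fun :: "nat \<Rightarrow> 'a :: comm_ring_1 \<Rightarrow> nat \<Rightarrow> ('a \<Rightarrow> real) set" where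
  "lc_fun p \<pi> l =
     {\<phi>. \<forall>i\<in>digit_sums p \<pi> l. \<forall>x\<in>adic_ball \<pi> l i. \<forall>y\<in>adic_ball \<pi> l i. \<phi> x = \<phi> y}"

definition lc_fun2 :: "nat \<Rightarrow> 'a :: comm_ring_1 \<Rightarrow> nat \<Rightarrow> ('a \<times> 'a \<Rightarrow> real) set" where
  "lc_fun2 p \<pi> l =
     {\<phi>. \<forall>i\<in>digit_sums p \<pi> l. \<forall>k\<in>digit_sums p \<pi> l.
           \<forall>x\<in>adic_ball \<pi> l i \<times> adic_ball \<pi> l k. \<forall>y\<in>adic_ball \<pi> l i \<times> adic_ball \<pi> l k. \<phi> x = \<phi> y}"

text \<open>
  The norm is only used for tuples of functions from the sets above, which take finitely many
  values, so that the suprema are those of bounded sets.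
\<close>

definition sup_norm_tuple :: "nat \<Rightarrow> (nat \<Rightarrow> 'b \<Rightarrow> real) \<Rightarrow> real" where
  "sup_norm_tuple R \<phi> = (MAX i\<in>{1..R}. SUP x. \<bar>\<phi> i x\<bar>)"

definition direct_sum_ball ::
  "nat \<Rightarrow> (nat \<Rightarrow> ('b \<Rightarrow> real) set) \<Rightarrow> (nat \<Rightarrow> 'b \<Rightarrow> real) \<Rightarrow> real \<Rightarrow> (nat \<Rightarrow> 'b \<Rightarrow> real) set" where
  "direct_sum_ball R V c r =
     {\<phi> \<in> Pi {1..R} V. sup_norm_tuple R (\<lambda>i x. \<phi> i x - c i x) < r}"

section \<open>Hierarchical deep neural networks\<close>

text \<open>
  The representative of the class of \<open>x\<close> modulo \<open>\<pi> ^ l\<close>.  The natural homomorphism from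
  level \<open>l\<close> to level \<open>l - 1\<close> is the restriction of \<open>representative p \<pi> (l - 1)\<close> to
  \<open>digit_sums p \<pi> l\<close>.
\<close>

definition representative :: "nat \<Rightarrow> 'a :: comm_ring_1 \<Rightarrow> nat \<Rightarrow> 'a \<Rightarrow> 'a" where
  "representative p \<pi> l x = (THE i. i \<in> digit_sums p \<pi> l \<and> x \<in> adic_ball \<pi> l i)"

text \<open>\<open>dnn_state p \<pi> s L w \<theta> X n\<close> is the state at level \<open>L + n\<close>, for the activation function \<open>s\<close>.\<close>

primrec dnn_state ::
  "nat \<Rightarrow> 'a :: comm_ring_1 \<Rightarrow> (real \<Rightarrow> real) \<Rightarrow> nat \<Rightarrow> ('a \<times> 'a \<Rightarrow> real) \<Rightarrow> ('a \<Rightarrow> real) \<Rightarrow>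
   ('a \<Rightarrow> real) \<Rightarrow> nat \<Rightarrow> 'a \<Rightarrow> real" where
  "dnn_state p \<pi> s L w \<theta> X 0 = X"
| "dnn_state p \<pi> s L w \<theta> X (Suc n) =
     (\<lambda>j. s ((\<Sum>k\<in>digit_sums p \<pi> (L + Suc n).
                w (j, k) * dnn_state p \<pi> s L w \<theta> X n (representative p \<pi> (L + n) k)) + \<theta> j))"

definition dnn_output ::
  "nat \<Rightarrow> 'a :: comm_ring_1 \<Rightarrow> (real \<Rightarrow> real) \<Rightarrow> nat \<Rightarrow> nat \<Rightarrow> ('a \<times> 'a \<Rightarrow> real) \<Rightarrow> ('a \<Rightarrow> real) \<Rightarrow>
   ('a \<Rightarrow> real) \<Rightarrow> 'a \<Rightarrow> real" where
  "dnn_output p \<pi> s L \<Delta> w \<theta> X x =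
     dnn_state p \<pi> s L w \<theta> X \<Delta> (representative p \<pi> (L + \<Delta>) x)"

definition dnn_product_output ::
  "nat \<Rightarrow> 'a :: comm_ring_1 \<Rightarrow> (nat \<Rightarrow> real \<Rightarrow> real) \<Rightarrow> (nat \<Rightarrow> nat) \<Rightarrow> (nat \<Rightarrow> nat) \<Rightarrow>
   (nat \<Rightarrow> 'a \<times> 'a \<Rightarrow> real) \<Rightarrow> (nat \<Rightarrow> 'a \<Rightarrow> real) \<Rightarrow>
   (nat \<Rightarrow> 'a \<Rightarrow> real) \<Rightarrow> nat \<Rightarrow> 'a \<Rightarrow> real" where
  "dnn_product_output p \<pi> s L \<Delta> w \<theta> X i = dnn_output p \<pi> (s i) (L i) (\<Delta> i) (w i) (\<theta> i) (X i)"

end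

theory Submission
  imports Defs
begin

text \<open>
  Locally constant functions are dense in the Lebesgue space (for \<open>\<rho> = \<infinity>\<close>, among the continuous
  functions), so it is enough to realize a locally constant \<open>h\<close> up to a small uniform error.  Take
  the base point \<open>w = 0\<close>: then only the last layer counts, and its output is \<open>h\<close> if \<open>\<theta>\<close> is a
  preimage of \<open>h\<close> under the activation function, scaled so that its range contains the values of \<open>h\<close>.
  The states are bounded, so the output is continuous in \<open>w\<close> and \<open>\<theta>\<close> at this point.  Both rings
  enter only through their adic balls: unique representatives, the topology, completeness.
\<close>

section \<open>Adic balls\<close>

text \<open>For finite rho the estimates concern the integral of the r-th power of the absolute
  value, not its root. This integral is subadditive only up to a constant factor, which is harmless
  as long as errors can be made arbitrarily small. An open set is a countable union of sets that are
  unions of balls of one level, so induction over the Borel sets can do the work of a regularity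
  argument. For \<rho> = \<infinity> compactness is used in the form of finitely many balls per
  level together with completeness. For finite rho the norm of \<open>f\<close> gives no bound on
  the values of \<open>h\<close>, so the scale is chosen only after \<open>h\<close>, and the radii
  after the scale. The states are bounded by the scale and the input alone, whatever the parameters
  are. Hence no error has to be propagated through the layers: whatever the lower layers do, small
  weights in the last one make their contribution small.\<close>

locale adic_ring =
  fixes p :: nat and \<pi> :: "'a :: {comm_ring_1, topological_space}"
  assumes ex1_digit_sum: "\<exists>!i. i \<in> digit_sums p \<pi> l \<and> x \<in> adic_ball \<pi> l i"
    and open_iff_adic_ball: "open U \<longleftrightarrow> (\<forall>x\<in>U. \<exists>l. adic_ball \<pi> l x \<subseteq> U)"
    and complete:
      "(\<And>n. a (Suc n) \<in> adic_ball \<pi> n (a n)) \<Longrightarrow> \<exists>x. \<forall>n. x \<in> adic_ball \<pi> n (a n)"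

lemma finite_digit_sums: "finite (digit_sums p \<pi> l)"
proof -
  have "digit_sums p \<pi> l \<subseteq> (\<lambda>d. \<Sum>j<l. of_nat (d j) * \<pi> ^ j) ` (PiE {..<l} (\<lambda>_. {..<p}))"
  proof
    fix x assume "x \<in> digit_sums p \<pi> l"
    then obtain d where d: "x = (\<Sum>j<l. of_nat (d j) * \<pi> ^ j)" "\<forall>j<l. d j < p"
      by (auto simp: digit_sums_def)
    show "x \<in> (\<lambda>d. \<Sum>j<l. of_nat (d j) * \<pi> ^ j) ` (PiE {..<l} (\<lambda>_. {..<p}))"
      by (rule image_eqI[of _ _ "restrict d {..<l}"]) (use d in auto)
  qed
  then show ?thesis
    by (rule finite_subset) (auto intro!: finite_imageI finite_PiE)
qed

lemma mem_adic_ball_iff_dvd: "x \<in> adic_ball \<pi> l a \<longleftrightarrow> \<pi> ^ l dvd x - a"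
  unfolding adic_ball_def dvd_def by (auto simp: image_iff algebra_simps)

lemma self_mem_adic_ball: "a \<in> adic_ball \<pi> l a"
  by (simp add: mem_adic_ball_iff_dvd)

text \<open>The ultrametric property in algebraic form: every point of a ball is a centre of
  it.\<close>

lemma adic_ball_eq:
  assumes "x \<in> adic_ball \<pi> l a"
  shows "adic_ball \<pi> l x = adic_ball \<pi> l a"
proof -
  have "\<pi> ^ l dvd y - x \<longleftrightarrow> \<pi> ^ l dvd y - a" for y
    using assms dvd_add[of "\<pi> ^ l" "y - x" "x - a"] dvd_diff[of "\<pi> ^ l" "y - a" "x - a"]
    by (auto simp: mem_adic_ball_iff_dvd)
  then show ?thesis
    by (auto simp: mem_adic_ball_iff_dvd)
qed

lemma adic_ball_antimono: "m \<le> l \<Longrightarrow> adic_ball \<pi> l a \<subseteq> adic_ball \<pi> m a"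
  by (auto simp: mem_adic_ball_iff_dvd intro: dvd_trans[OF le_imp_power_dvd])

context adic_ring
begin

lemma representative:
  shows representative_mem: "representative p \<pi> l x \<in> digit_sums p \<pi> l"
    and mem_adic_ball_representative: "x \<in> adic_ball \<pi> l (representative p \<pi> l x)"
  using theI'[OF ex1_digit_sum[of l x]] by (auto simp: representative_def)

lemma adic_ball_representative: "adic_ball \<pi> l (representative p \<pi> l x) = adic_ball \<pi> l x"
  using adic_ball_eq[OF mem_adic_ball_representative] by simp

lemma representative_cong:
  "y \<in> adic_ball \<pi> l x \<Longrightarrow> representative p \<pi> l y = representative p \<pi> l x"
  unfolding representative_def
  by (metis adic_ball_eq self_mem_adic_ball)

lemma mem_lc_fun_iff: "\<phi> \<in> lc_fun p \<pi> l \<longleftrightarrow> (\<forall>x. \<forall>y\<in>adic_ball \<pi> l x. \<phi> y = \<phi> x)"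
proof
  assume *: "\<phi> \<in> lc_fun p \<pi> l"
  show "\<forall>x. \<forall>y\<in>adic_ball \<pi> l x. \<phi> y = \<phi> x"
  proof safe
    fix x y assume "y \<in> adic_ball \<pi> l x"
    then show "\<phi> y = \<phi> x"
      using * representative_mem[of l x] adic_ball_representative[of l x] self_mem_adic_ball[of x \<pi> l]
      unfolding lc_fun_def by blast
  qed
next
  assume "\<forall>x. \<forall>y\<in>adic_ball \<pi> l x. \<phi> y = \<phi> x"
  then show "\<phi> \<in> lc_fun p \<pi> l"
    unfolding lc_fun_def by fastforce
qed

lemma lc_fun_representative: "\<phi> \<in> lc_fun p \<pi> l \<Longrightarrow> \<phi> (representative p \<pi> l x) = \<phi> x"
  using mem_adic_ball_representative mem_lc_fun_iff by metis

lemma lc_fun_mono: "m \<le> l \<Longrightarrow> \<phi> \<in> lc_fun p \<pi> m \<Longrightarrow> \<phi> \<in> lc_fun p \<pi> l"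
  using adic_ball_antimono unfolding mem_lc_fun_iff by blast

lemma comp_representative_mem_lc_fun: "(\<lambda>x. h (representative p \<pi> l x)) \<in> lc_fun p \<pi> l"
  unfolding mem_lc_fun_iff using representative_cong by metis

text \<open>Finiteness supplies the bounds on \<open>h\<close> and on the input, and it makes the
  real \<open>SUP\<close> in \<open>sup_norm_tuple\<close> a genuine upper bound.\<close>

lemma finite_range_lc_fun:
  assumes "\<phi> \<in> lc_fun p \<pi> l"
  shows "finite (range \<phi>)"
proof (rule finite_subset)
  show "range \<phi> \<subseteq> \<phi> ` digit_sums p \<pi> l"
    using lc_fun_representative[OF assms] representative_mem by (metis image_subset_iff rev_image_eqI)
qed (simp add: finite_digit_sums)

lemma finite_range_lc_fun2:
  assumes "\<phi> \<in> lc_fun2 p \<pi> l"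
  shows "finite (range \<phi>)"
proof (rule finite_subset)
  show "range \<phi> \<subseteq> \<phi> ` (digit_sums p \<pi> l \<times> digit_sums p \<pi> l)"
  proof safe
    fix x y
    let ?z = "(representative p \<pi> l x, representative p \<pi> l y)"
    have "\<phi> a = \<phi> b"
      if "a \<in> adic_ball \<pi> l (fst ?z) \<times> adic_ball \<pi> l (snd ?z)"
        and "b \<in> adic_ball \<pi> l (fst ?z) \<times> adic_ball \<pi> l (snd ?z)" for a b
      using assms that representative_mem[of l x] representative_mem[of l y]
      unfolding lc_fun2_def mem_Collect_eq fst_conv snd_conv by blast
    from this[of "(x, y)" ?z] have "\<phi> (x, y) = \<phi> ?z"
      by (simp add: mem_adic_ball_representative self_mem_adic_ball)
    then show "\<phi> (x, y) \<in> \<phi> ` (digit_sums p \<pi> l \<times> digit_sums p \<pi> l)"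
      using representative_mem by auto
  qed
qed (simp add: finite_digit_sums)

text \<open>The preimage of any set of reals is a union of balls, hence open.\<close>

lemma borel_measurable_lc_fun:
  assumes "sets \<mu> = sets borel" "\<phi> \<in> lc_fun p \<pi> l"
  shows "\<phi> \<in> borel_measurable \<mu>"
proof (rule borel_measurableI)
  fix S :: "real set"
  have "open (\<phi> -` S)"
    using assms(2) unfolding open_iff_adic_ball mem_lc_fun_iff by (metis subsetI vimage_eq)
  then show "\<phi> -` S \<inter> space \<mu> \<in> sets \<mu>"
    using assms(1) sets_eq_imp_space_eq[OF assms(1)] by simp
qed

section \<open>Uniform approximation of continuous functions\<close>

text \<open>
  A ball on which \<open>g\<close> is not uniformly close to locally constant functions has such a subball one
  level below; the point common to a descending sequence of them contradicts continuity there.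
\<close>

lemma uniformly_continuous_adic:
  fixes g :: "'a \<Rightarrow> real"
  assumes cont: "continuous_on UNIV g" and "0 < e"
  shows "\<exists>m. \<forall>x. \<forall>y\<in>adic_ball \<pi> m x. \<bar>g y - g x\<bar> < e"
proof (rule ccontr)
  assume contra: "\<not> ?thesis"
  \<comment> \<open>A ball is good if one level \<open>m\<close> serves as modulus of continuity for
    all its points.\<close>
  define good where
    "good l a \<longleftrightarrow> (\<exists>m. \<forall>x\<in>adic_ball \<pi> l a. \<forall>y\<in>adic_ball \<pi> m x. \<bar>g y - g x\<bar> < e)" for l a
  have "\<exists>b\<in>adic_ball \<pi> l a. \<not> good (Suc l) b" if "\<not> good l a" for l a
  proof (rule ccontr)
    assume "\<not> ?thesis"
    then have "\<forall>b. \<exists>m. b \<in> adic_ball \<pi> l a \<longrightarrow>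
        (\<forall>x\<in>adic_ball \<pi> (Suc l) b. \<forall>y\<in>adic_ball \<pi> m x. \<bar>g y - g x\<bar> < e)"
      unfolding good_def by blast
    then obtain m where m: "\<And>b x y. b \<in> adic_ball \<pi> l a \<Longrightarrow> x \<in> adic_ball \<pi> (Suc l) b \<Longrightarrow>
        y \<in> adic_ball \<pi> (m b) x \<Longrightarrow> \<bar>g y - g x\<bar> < e"
      by metis
    \<comment> \<open>The ball meets only finitely many balls of the next level, so the finest of
      their moduli serves the whole ball.\<close>
    define k where "k = Max (m ` digit_sums p \<pi> (Suc l))"
    have "\<bar>g y - g x\<bar> < e" if x: "x \<in> adic_ball \<pi> l a" and y: "y \<in> adic_ball \<pi> k x" for x y
    proof -
      let ?b = "representative p \<pi> (Suc l) x"
      have xb: "x \<in> adic_ball \<pi> (Suc l) ?b"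
        by (rule mem_adic_ball_representative)
      have "adic_ball \<pi> l ?b = adic_ball \<pi> l a"
        using xb x adic_ball_eq adic_ball_antimono[of l "Suc l"] by (metis le_add2 plus_1_eq_Suc subsetD)
      then have "?b \<in> adic_ball \<pi> l a"
        using self_mem_adic_ball by metis
      moreover have "m ?b \<le> k"
        unfolding k_def by (intro Max_ge finite_imageI finite_digit_sums imageI representative_mem)
      then have "y \<in> adic_ball \<pi> (m ?b) x"
        using y adic_ball_antimono by blast
      ultimately show ?thesis
        using m xb by blast
    qed
    with that show False
      unfolding good_def by blast
  qed
  then obtain c where c: "\<And>l a. \<not> good l a \<Longrightarrow> c l a \<in> adic_ball \<pi> l a"
      "\<And>l a. \<not> good l a \<Longrightarrow> \<not> good (Suc l) (c l a)"
    by metis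
  \<comment> \<open>The descent starts from the ball of level 0, which is the whole ring because
    \<open>\<pi> ^ 0 = 1\<close>.\<close>
  define a where "a = rec_nat 0 c"
  have a_Suc: "a (Suc n) = c n (a n)" for n
    by (simp add: a_def)
  have bad: "\<not> good n (a n)" for n
  proof (induction n)
    case 0
    show ?case
      using contra by (auto simp: good_def a_def adic_ball_def)
  qed (simp add: a_Suc c)
  obtain x where x: "\<And>n. x \<in> adic_ball \<pi> n (a n)"
    using complete[of a] c(1)[OF bad] a_Suc by metis
  \<comment> \<open>Half of \<open>e\<close>, because two arbitrary points of a ball are compared
    through the limit point \<open>x\<close>.\<close>
  have "open (g -` ball (g x) (e / 2))"
    using cont by (rule open_vimage[rotated]) simp
  then obtain l where l: "adic_ball \<pi> l x \<subseteq> g -` ball (g x) (e / 2)"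
    using \<open>0 < e\<close> unfolding open_iff_adic_ball by (metis centre_in_ball half_gt_zero vimageI)
  have "good l (a l)"
    unfolding good_def
  proof (intro exI ballI)
    fix y z assume "y \<in> adic_ball \<pi> l (a l)" "z \<in> adic_ball \<pi> l y"
    then have "y \<in> adic_ball \<pi> l x" "z \<in> adic_ball \<pi> l x"
      using x[of l] adic_ball_eq by metis+
    then have "dist (g x) (g y) < e / 2" "dist (g x) (g z) < e / 2"
      using l by auto
    then show "\<bar>g z - g y\<bar> < e"
      by (simp only: dist_real_def)
  qed
  with bad show False
    by blast
qed

lemma uniform_approx_lc_fun:
  fixes g :: "'a \<Rightarrow> real"
  assumes "continuous_on UNIV g" "0 < e"
  shows "\<exists>l. \<exists>h\<in>lc_fun p \<pi> l. \<forall>x. \<bar>g x - h x\<bar> < e"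
proof -
  obtain m where m: "\<forall>x. \<forall>y\<in>adic_ball \<pi> m x. \<bar>g y - g x\<bar> < e"
    using uniformly_continuous_adic[OF assms] by blast
  show ?thesis
    using m mem_adic_ball_representative
    by (intro exI[of _ m] bexI[OF _ comp_representative_mem_lc_fun[of g]]) blast
qed

end

section \<open>Approximation in Lebesgue spaces\<close>

text \<open>A substitute for the Minkowski inequality: the sum is at most twice the larger
  term.\<close>

lemma powr_triangle:
  fixes a b :: real
  assumes "0 \<le> r"
  shows "\<bar>a + b\<bar> powr r \<le> 2 powr r * (\<bar>a\<bar> powr r + \<bar>b\<bar> powr r)"
proof -
  have "\<bar>a + b\<bar> powr r \<le> (2 * max \<bar>a\<bar> \<bar>b\<bar>) powr r"
    using assms by (intro powr_mono2) auto
  also have "\<dots> = 2 powr r * (max \<bar>a\<bar> \<bar>b\<bar>) powr r"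
    by (simp add: powr_mult)
  also have "max \<bar>a\<bar> \<bar>b\<bar> powr r \<le> \<bar>a\<bar> powr r + \<bar>b\<bar> powr r"
    by (simp add: max_def)
  finally show ?thesis
    by simp
qed

text \<open>The setting for finite rho, with \<open>r\<close> its real value. Total mass one makes
  constants integrable and turns uniform bounds into bounds on integrals.\<close>

locale adic_prob = adic_ring p \<pi> for p and \<pi> :: "'a :: {comm_ring_1, topological_space}" +
  fixes \<mu> :: "'a measure" and r :: real
  assumes sets_eq [measurable_cong]: "sets \<mu> = sets borel" and emeasure_UNIV: "emeasure \<mu> UNIV = 1"
    and r_pos: "0 < r"
begin

lemma space_eq: "space \<mu> = UNIV"
  using sets_eq_imp_space_eq[OF sets_eq] by simp

abbreviation I :: "('a \<Rightarrow> real) \<Rightarrow> ennreal" where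
  "I h \<equiv> \<integral>\<^sup>+ x. ennreal (\<bar>h x\<bar> powr r) \<partial>\<mu>"

text \<open>Closeness is measured by \<open>I\<close>, so that roots are taken only once, when the
  norm is reached at the end.\<close>

definition approximable :: "('a \<Rightarrow> real) \<Rightarrow> bool" where
  "approximable f \<longleftrightarrow>
     f \<in> borel_measurable \<mu> \<and> (\<forall>e>0. \<exists>l. \<exists>g\<in>lc_fun p \<pi> l. I (\<lambda>x. f x - g x) < ennreal e)"

lemma measurable_lc_fun: "g \<in> lc_fun p \<pi> l \<Longrightarrow> g \<in> borel_measurable \<mu>"
  by (rule borel_measurable_lc_fun[OF sets_eq])

text \<open>A single estimate for sums, maxima, complements and multiples: all of them are Lipschitz
  in two arguments. The factor combines \<open>K powr r\<close> with the \<open>2 powr r\<close> of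
  \<open>powr_triangle\<close>.\<close>

lemma I_Lipschitz:
  assumes [measurable]: "f1 \<in> borel_measurable \<mu>" "f2 \<in> borel_measurable \<mu>"
    and le: "\<And>x. \<bar>h x\<bar> \<le> K * (\<bar>f1 x\<bar> + \<bar>f2 x\<bar>)" and "0 \<le> K"
  shows "I h \<le> ennreal ((2 * K) powr r) * (I f1 + I f2)"
proof -
  have "I h \<le> (\<integral>\<^sup>+ x. ennreal ((2 * K) powr r) * (ennreal (\<bar>f1 x\<bar> powr r) + ennreal (\<bar>f2 x\<bar> powr r)) \<partial>\<mu>)"
  proof (rule nn_integral_mono)
    fix x
    have "\<bar>h x\<bar> powr r \<le> (K * (\<bar>f1 x\<bar> + \<bar>f2 x\<bar>)) powr r"
      using le r_pos by (intro powr_mono2) auto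
    also have "\<dots> = K powr r * (\<bar>f1 x\<bar> + \<bar>f2 x\<bar>) powr r"
      using \<open>0 \<le> K\<close> by (simp add: powr_mult)
    also have "\<dots> \<le> K powr r * (2 powr r * (\<bar>f1 x\<bar> powr r + \<bar>f2 x\<bar> powr r))"
      using powr_triangle[of r "\<bar>f1 x\<bar>" "\<bar>f2 x\<bar>"] r_pos by (intro mult_left_mono) auto
    also have "\<dots> = (2 * K) powr r * (\<bar>f1 x\<bar> powr r + \<bar>f2 x\<bar> powr r)"
      using \<open>0 \<le> K\<close> by (simp add: powr_mult)
    finally show "ennreal (\<bar>h x\<bar> powr r) \<le>
        ennreal ((2 * K) powr r) * (ennreal (\<bar>f1 x\<bar> powr r) + ennreal (\<bar>f2 x\<bar> powr r))"
      by (simp add: ennreal_mult[symmetric] ennreal_plus[symmetric] ennreal_leI del: ennreal_plus)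
  qed
  also have "\<dots> = ennreal ((2 * K) powr r) * (I f1 + I f2)"
    by (subst nn_integral_cmult) (simp_all add: nn_integral_add)
  finally show ?thesis .
qed

lemma ex_small_error:
  assumes "0 < (e :: real)" "0 \<le> K"
  obtains d :: real where "0 < d"
    "\<And>u v. u < ennreal d \<Longrightarrow> v < ennreal d \<Longrightarrow> ennreal ((2 * K) powr r) * (u + v) < ennreal e"
proof
  define C where "C = (2 * K) powr r"
  \<comment> \<open>Then \<open>C * (?d + ?d)\<close> is at most \<open>e / 2\<close>; the summand 1
    keeps the denominator positive when \<open>C = 0\<close>.\<close>
  let ?d = "e / (4 * (C + 1))"
  have C: "0 \<le> C"
    by (simp add: C_def)
  show d: "0 < ?d"
    using assms C by simp
  show "ennreal ((2 * K) powr r) * (u + v) < ennreal e" if "u < ennreal ?d" "v < ennreal ?d" for u v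
  proof -
    have "u + v \<le> ennreal ?d + ennreal ?d"
      using that by (intro add_mono) auto
    then have "ennreal C * (u + v) \<le> ennreal C * (ennreal ?d + ennreal ?d)"
      by (intro mult_left_mono) auto
    also have "\<dots> = ennreal (C * (?d + ?d))"
      using C d by (simp only: ennreal_mult ennreal_plus less_imp_le add_nonneg_nonneg)
    also have "\<dots> < ennreal e"
    proof (rule ennreal_lessI)
      show "C * (?d + ?d) < e"
        using C assms by (simp add: field_simps add_pos_nonneg add_strict_increasing)
    qed (use assms in simp)
    finally show ?thesis
      by (simp add: C_def)
  qed
qed

section \<open>Closure properties of the approximable functions\<close>

lemma approximable_closure:
  assumes [measurable]: "f \<in> borel_measurable \<mu>"
    and close: "\<And>e. 0 < e \<Longrightarrow> \<exists>h. approximable h \<and> I (\<lambda>x. f x - h x) < ennreal e"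
  shows "approximable f"
  unfolding approximable_def
proof (intro conjI allI impI)
  fix e :: real assume "0 < e"
  obtain d :: real where "0 < d" and d:
    "\<And>u v. u < ennreal d \<Longrightarrow> v < ennreal d \<Longrightarrow> ennreal ((2 * 1) powr r) * (u + v) < ennreal e"
    using ex_small_error[OF \<open>0 < e\<close>, of 1] by auto
  obtain h where h: "approximable h" "I (\<lambda>x. f x - h x) < ennreal d"
    using close[OF \<open>0 < d\<close>] by blast
  then obtain l g where g: "g \<in> lc_fun p \<pi> l" "I (\<lambda>x. h x - g x) < ennreal d"
    using \<open>0 < d\<close> unfolding approximable_def by blast
  have [measurable]: "h \<in> borel_measurable \<mu>" "g \<in> borel_measurable \<mu>"
    using h(1) measurable_lc_fun[OF g(1)] by (auto simp: approximable_def)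
  have "I (\<lambda>x. f x - g x) \<le> ennreal ((2 * 1) powr r) * (I (\<lambda>x. f x - h x) + I (\<lambda>x. h x - g x))"
    by (rule I_Lipschitz) auto
  also have "\<dots> < ennreal e"
    by (rule d) fact+
  finally show "\<exists>l. \<exists>g\<in>lc_fun p \<pi> l. I (\<lambda>x. f x - g x) < ennreal e"
    using g(1) by blast
qed fact

text \<open>Applying \<open>G\<close> to locally constant approximants gives a function that is
  locally constant at the finer of their two levels.\<close>

lemma approximable_Lipschitz:
  assumes f: "approximable f1" "approximable f2"
    and [measurable]: "(\<lambda>x. G (f1 x) (f2 x)) \<in> borel_measurable \<mu>"
    and G: "\<And>a b a' b'. \<bar>G a b - G a' b'\<bar> \<le> K * (\<bar>a - a'\<bar> + \<bar>b - b'\<bar>)" and "0 \<le> K"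
  shows "approximable (\<lambda>x. G (f1 x) (f2 x))"
  unfolding approximable_def
proof (intro conjI allI impI)
  fix e :: real assume "0 < e"
  obtain d :: real where "0 < d" and d:
    "\<And>u v. u < ennreal d \<Longrightarrow> v < ennreal d \<Longrightarrow> ennreal ((2 * K) powr r) * (u + v) < ennreal e"
    using ex_small_error[OF \<open>0 < e\<close> \<open>0 \<le> K\<close>] by blast
  obtain l1 g1 where g1: "g1 \<in> lc_fun p \<pi> l1" "I (\<lambda>x. f1 x - g1 x) < ennreal d"
    using f(1) \<open>0 < d\<close> unfolding approximable_def by blast
  obtain l2 g2 where g2: "g2 \<in> lc_fun p \<pi> l2" "I (\<lambda>x. f2 x - g2 x) < ennreal d"
    using f(2) \<open>0 < d\<close> unfolding approximable_def by blast
  have [measurable]: "f1 \<in> borel_measurable \<mu>" "f2 \<in> borel_measurable \<mu>"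
      "g1 \<in> borel_measurable \<mu>" "g2 \<in> borel_measurable \<mu>"
    using f measurable_lc_fun g1(1) g2(1) by (auto simp: approximable_def)
  have "I (\<lambda>x. G (f1 x) (f2 x) - G (g1 x) (g2 x)) \<le>
      ennreal ((2 * K) powr r) * (I (\<lambda>x. f1 x - g1 x) + I (\<lambda>x. f2 x - g2 x))"
    using G \<open>0 \<le> K\<close> by (intro I_Lipschitz) auto
  also have "\<dots> < ennreal e"
    by (rule d) fact+
  finally have "I (\<lambda>x. G (f1 x) (f2 x) - G (g1 x) (g2 x)) < ennreal e" .
  moreover have "(\<lambda>x. G (g1 x) (g2 x)) \<in> lc_fun p \<pi> (max l1 l2)"
    using lc_fun_mono[OF _ g1(1), of "max l1 l2"] lc_fun_mono[OF _ g2(1), of "max l1 l2"]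
    by (simp add: mem_lc_fun_iff)
  ultimately show "\<exists>l. \<exists>g\<in>lc_fun p \<pi> l. I (\<lambda>x. G (f1 x) (f2 x) - g x) < ennreal e"
    by (intro exI bexI[of _ "\<lambda>x. G (g1 x) (g2 x)"])
qed fact

lemma approximable_dominated_limit:
  assumes h: "\<And>n. approximable (h n)" and lim: "\<And>x. (\<lambda>n. h n x) \<longlonglongrightarrow> f x"
    and le: "\<And>n x. \<bar>f x - h n x\<bar> \<le> w x" and w [measurable]: "w \<in> borel_measurable \<mu>" and fin: "I w < \<infinity>"
  shows "approximable f"
proof (rule approximable_closure)
  have [measurable]: "h n \<in> borel_measurable \<mu>" for n
    using h by (simp add: approximable_def)
  show [measurable]: "f \<in> borel_measurable \<mu>"
    by (rule borel_measurable_LIMSEQ_real[OF lim]) auto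
  have "(\<lambda>n. I (\<lambda>x. f x - h n x)) \<longlonglongrightarrow> (\<integral>\<^sup>+ x. 0 \<partial>\<mu>)"
  proof (rule nn_integral_dominated_convergence[where w = "\<lambda>x. ennreal (\<bar>w x\<bar> powr r)"])
    show "AE x in \<mu>. ennreal (\<bar>f x - h n x\<bar> powr r) \<le> ennreal (\<bar>w x\<bar> powr r)" for n
      using le r_pos by (intro always_eventually allI ennreal_leI powr_mono2) (auto intro: order_trans[OF _ abs_ge_self])
    show "AE x in \<mu>. (\<lambda>n. ennreal (\<bar>f x - h n x\<bar> powr r)) \<longlonglongrightarrow> 0"
    proof (intro always_eventually allI)
      fix x
      have "(\<lambda>n. \<bar>f x - h n x\<bar>) \<longlonglongrightarrow> 0"
        using lim[of x] by (intro tendsto_rabs_zero) (simp add: LIM_zero_cancel tendsto_diff[OF tendsto_const lim, of "f x" x, simplified])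
      then have "(\<lambda>n. \<bar>f x - h n x\<bar> powr r) \<longlonglongrightarrow> 0 powr r"
        using r_pos by (intro tendsto_powr2) auto
      then show "(\<lambda>n. ennreal (\<bar>f x - h n x\<bar> powr r)) \<longlonglongrightarrow> 0"
        using r_pos by (auto dest: tendsto_ennrealI)
    qed
  qed (use fin in auto)
  then have *: "(\<lambda>n. I (\<lambda>x. f x - h n x)) \<longlonglongrightarrow> 0"
    by simp
  show "\<exists>h. approximable h \<and> I (\<lambda>x. f x - h x) < ennreal e" if "0 < e" for e
    using order_tendstoD(2)[OF *, of "ennreal e"] that h by (auto simp: eventually_sequentially)
qed

lemma approximable_zero: "approximable (\<lambda>_. 0)"
proof -
  have "(\<lambda>_. 0) \<in> lc_fun p \<pi> 0"
    by (simp add: mem_lc_fun_iff)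
  then show ?thesis
    using r_pos by (auto simp: approximable_def intro!: exI[of _ 0] bexI[of _ "\<lambda>_. 0"])
qed

text \<open>Finite unions are maxima of indicators, and the maximum is Lipschitz. The countable
  union is their pointwise limit, dominated by the constant 1. Disjointness is not involved, so the
  induction over generated sets can use arbitrary countable unions.\<close>

lemma approximable_UN:
  fixes A :: "nat \<Rightarrow> 'a set"
  assumes "\<And>n. approximable (indicat_real (A n))"
  shows "approximable (indicat_real (\<Union>n. A n))"
proof -
  have "approximable (indicat_real (\<Union>i<n. A i))" for n
  proof (induction n)
    case 0
    have "indicat_real {} = (\<lambda>_ :: 'a. 0)"
      by (simp add: fun_eq_iff)
    then show ?case
      using approximable_zero by simp
  next
    case (Suc n)
    have [measurable]: "indicat_real (\<Union>i<n. A i) \<in> borel_measurable \<mu>" "indicat_real (A n) \<in> borel_measurable \<mu>"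
      using Suc.IH assms by (simp_all only: approximable_def)
    have eq: "indicat_real (\<Union>i<Suc n. A i) = (\<lambda>x. max (indicat_real (\<Union>i<n. A i) x) (indicat_real (A n) x))"
      by (auto simp: fun_eq_iff indicator_def less_Suc_eq max_def)
    show ?case
      unfolding eq by (rule approximable_Lipschitz[OF Suc.IH assms, where K = 1]) (auto simp: max_def)
  qed
  then show ?thesis
  proof (rule approximable_dominated_limit[where w = "\<lambda>_. 1"])
    show "(\<lambda>n. indicat_real (\<Union>i<n. A i) x) \<longlonglongrightarrow> indicat_real (\<Union>n. A n) x" for x
    proof (cases "x \<in> (\<Union>n. A n)")
      case True
      then obtain k where "x \<in> A k"
        by blast
      then have "\<forall>n\<ge>Suc k. indicat_real (\<Union>i<n. A i) x = indicat_real (\<Union>n. A n) x"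
        by (auto simp: indicator_def Suc_le_eq)
      then show ?thesis
        by (intro tendsto_eventually eventually_sequentiallyI[of "Suc k"]) auto
    next
      case False
      then show ?thesis
        by (intro tendsto_eventually always_eventually) (auto simp: indicator_def)
    qed
  qed (auto simp: indicator_def space_eq emeasure_UNIV)
qed

lemma approximable_indicator:
  assumes "A \<in> sets \<mu>"
  shows "approximable (indicat_real A)"
proof -
  have "A \<in> sigma_sets UNIV {S. open S}"
    using assms by (simp add: sets_eq borel_def)
  then show ?thesis
  proof induction
    case (Basic U)
    \<comment> \<open>\<open>V n\<close> is the union of the balls of level \<open>n\<close> inside
      \<open>U\<close>. These sets exhaust \<open>U\<close> because every point of an open set has a
      ball inside it.\<close>
    define V where "V n = {x. adic_ball \<pi> n x \<subseteq> U}" for n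
    have "indicat_real (V n) \<in> lc_fun p \<pi> n" for n
      unfolding mem_lc_fun_iff
      by (auto simp: V_def indicator_def adic_ball_eq)
    then have "approximable (indicat_real (V n))" for n
      using measurable_lc_fun r_pos by (auto simp: approximable_def intro!: exI[of _ n] bexI[of _ "indicat_real (V n)"])
    moreover have "(\<Union>n. V n) = U"
      using Basic self_mem_adic_ball[of _ \<pi>] by (fastforce simp: V_def open_iff_adic_ball)
    ultimately show ?case
      using approximable_UN by metis
  next
    case Empty
    have "indicat_real {} = (\<lambda>_ :: 'a. 0)"
      by (simp add: fun_eq_iff)
    then show ?case
      using approximable_zero by simp
  next
    case (Compl A)
    have [measurable]: "indicat_real A \<in> borel_measurable \<mu>"
      using Compl.IH by (simp only: approximable_def)
    have eq: "indicat_real (UNIV - A) = (\<lambda>x. 1 - indicat_real A x)"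
      by (auto simp: fun_eq_iff indicator_def)
    show ?case
      unfolding eq by (rule approximable_Lipschitz[OF Compl.IH Compl.IH, where K = 1]) auto
  next
    case (Union A)
    then show ?case
      by (intro approximable_UN)
  qed
qed

lemma approximable_simple_function:
  fixes f :: "'a \<Rightarrow> real"
  assumes f: "simple_function \<mu> f"
  shows "approximable f"
proof -
  have "approximable (\<lambda>x. \<Sum>y\<in>S. y * indicat_real (f -` {y}) x)" if "finite S" for S
    using that
  proof induction
    case empty
    show ?case
      by (simp add: approximable_zero)
  next
    case (insert y S)
    have "f -` {y} \<in> sets \<mu>"
      using simple_functionD(2)[OF f, of "{y}"] by (simp add: space_eq)
    from approximable_indicator[OF this] have ind: "approximable (indicat_real (f -` {y}))" .
    have [measurable]: "indicat_real (f -` {y}) \<in> borel_measurable \<mu>"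
        "(\<lambda>x. \<Sum>y\<in>S. y * indicat_real (f -` {y}) x) \<in> borel_measurable \<mu>"
      using ind insert.IH by (simp_all only: approximable_def)
    \<comment> \<open>Adding one value \<open>y\<close> of \<open>f\<close> is the map
      \<open>y * a + b\<close>; the factor \<open>\<bar>y\<bar> + 1\<close> dominates both partial
      slopes.\<close>
    have "\<bar>(y * a + b) - (y * a' + b')\<bar> \<le> (\<bar>y\<bar> + 1) * (\<bar>a - a'\<bar> + \<bar>b - b'\<bar>)" for a b a' b'
    proof -
      have "\<bar>(y * a + b) - (y * a' + b')\<bar> \<le> \<bar>y * (a - a')\<bar> + \<bar>b - b'\<bar>"
        by (simp only: right_diff_distrib)
      also have "\<dots> \<le> (\<bar>y\<bar> + 1) * \<bar>a - a'\<bar> + (\<bar>y\<bar> + 1) * \<bar>b - b'\<bar>"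
        by (simp only: abs_mult distrib_right) simp
      finally show ?thesis
        by (simp add: algebra_simps)
    qed
    then have "approximable (\<lambda>x. y * indicat_real (f -` {y}) x + (\<Sum>y\<in>S. y * indicat_real (f -` {y}) x))"
      by (intro approximable_Lipschitz[OF ind insert.IH, where K = "\<bar>y\<bar> + 1" and G = "\<lambda>a b. y * a + b"]) auto
    then show ?case
      by (simp only: sum.insert[OF insert.hyps])
  qed
  moreover have "finite (range f)"
    using simple_functionD(1)[OF f] by (simp add: space_eq)
  moreover have "(\<lambda>x. \<Sum>y\<in>range f. y * indicat_real (f -` {y}) x) = f"
  proof
    fix x
    have "(\<Sum>y\<in>range f. y * indicat_real (f -` {y}) x) = (\<Sum>y\<in>range f. if y = f x then y else 0)"
      by (intro sum.cong) (auto simp: indicator_def)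
    then show "(\<Sum>y\<in>range f. y * indicat_real (f -` {y}) x) = f x"
      using \<open>finite (range f)\<close> by simp
  qed
  ultimately show ?thesis
    by metis
qed

lemma approximableI:
  assumes [measurable]: "f \<in> borel_measurable \<mu>" and fin: "I f < \<infinity>"
  shows "approximable f"
proof -
  obtain s where s: "\<And>n. simple_function \<mu> (s n)" "\<And>x. (\<lambda>n. s n x) \<longlonglongrightarrow> f x"
      "\<And>n x. \<bar>s n x\<bar> \<le> 2 * \<bar>f x\<bar>"
    using borel_measurable_implies_sequence_metric[OF assms(1), of 0] by (auto simp: space_eq)
  show ?thesis
  proof (rule approximable_dominated_limit[OF approximable_simple_function[OF s(1)] s(2)])
    \<comment> \<open>The approximating sequence satisfies
      \<open>\<bar>s n x\<bar> \<le> 2 * \<bar>f x\<bar>\<close>, whence the factor 3 in the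
      dominating function.\<close>
    show "\<bar>f x - s n x\<bar> \<le> 3 * \<bar>f x\<bar>" for n x
      using s(3)[of n x] by linarith
    have "I (\<lambda>x. 3 * \<bar>f x\<bar>) \<le> ennreal ((2 * 3) powr r) * (I f + I f)"
      by (rule I_Lipschitz) auto
    also have "\<dots> < \<infinity>"
      using fin by (auto simp: ennreal_mult_less_top)
    finally show "I (\<lambda>x. 3 * \<bar>f x\<bar>) < \<infinity>" .
  qed simp
qed

end

section \<open>From integrals of powers to norms, including the essential supremum\<close>

context adic_ring
begin

text \<open>The statement quantifies over all measurable \<open>Y\<close> uniformly near
  \<open>h\<close> because the output moves with the parameters; one tolerance \<open>d\<close> has
  to serve for all of them.\<close>

lemma Lp_norm_approx_lc_fun:
  assumes sets_eq: "sets \<mu> = sets borel" and emeasure: "emeasure \<mu> UNIV = 1"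
    and \<rho>: "1 \<le> \<rho>" and f: "f \<in> Lp_space \<rho> \<mu>"
    and f_inf: "\<rho> = \<infinity> \<Longrightarrow> \<exists>g. continuous_on UNIV g \<and> (AE x in \<mu>. f x = g x)" and "0 < e"
  shows "\<exists>d>0. \<exists>l. \<exists>h\<in>lc_fun p \<pi> l. \<forall>Y\<in>borel_measurable \<mu>.
           (\<forall>x. \<bar>Y x - h x\<bar> < d) \<longrightarrow> Lp_norm \<rho> \<mu> (\<lambda>x. Y x - f x) < ennreal e"
proof (cases "\<rho> = \<infinity>")
  case True
  obtain g where g: "continuous_on UNIV g" "AE x in \<mu>. f x = g x"
    using f_inf[OF True] by blast
  \<comment> \<open>Two errors of \<open>e / 4\<close> give an essential supremum of at most
    \<open>e / 2\<close>. The slack keeps the final inequality strict, since an essential supremum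
    preserves only weak bounds.\<close>
  obtain l h where h: "h \<in> lc_fun p \<pi> l" "\<And>x. \<bar>g x - h x\<bar> < e / 4"
    using uniform_approx_lc_fun[OF g(1), of "e / 4"] \<open>0 < e\<close> by auto
  have "Lp_norm \<rho> \<mu> (\<lambda>x. Y x - f x) < ennreal e"
    if [measurable]: "Y \<in> borel_measurable \<mu>" and Y: "\<And>x. \<bar>Y x - h x\<bar> < e / 4" for Y
  proof -
    have [measurable]: "f \<in> borel_measurable \<mu>"
      using f by (simp add: Lp_space_def)
    have "esssup \<mu> (\<lambda>x. ennreal \<bar>Y x - f x\<bar>) \<le> ennreal (e / 2)"
    proof (rule esssup_I)
      show "AE x in \<mu>. ennreal \<bar>Y x - f x\<bar> \<le> ennreal (e / 2)"
        using g(2)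
      proof eventually_elim
        case (elim x)
        then show ?case
          using h(2)[of x] Y[of x] by (intro ennreal_leI) linarith
      qed
    qed simp
    also have "\<dots> < ennreal e"
      using \<open>0 < e\<close> by (intro ennreal_lessI) auto
    finally show ?thesis
      using True by (simp add: Lp_norm_def)
  qed
  then show ?thesis
    using h(1) \<open>0 < e\<close> by (intro exI[of _ "e / 4"] conjI exI[of _ l] bexI[of _ h]) auto
next
  case False
  define r where "r = enn2real \<rho>"
  have "0 < r"
    unfolding r_def using False \<rho> by (auto simp: enn2real_positive_iff top.not_eq_extremum intro: less_le_trans[OF zero_less_one])
  interpret adic_prob p \<pi> \<mu> r
    by unfold_locales (use sets_eq emeasure \<open>0 < r\<close> in auto)
  have [measurable]: "f \<in> borel_measurable \<mu>"
    using f by (simp add: Lp_space_def)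
  have "I f < \<infinity>"
    using f False by (auto simp: Lp_space_def Lp_norm_def r_def Let_def top.not_eq_extremum split: if_splits)
  then have approx: "approximable f"
    by (intro approximableI) auto
  \<comment> \<open>A bound \<open>e powr r\<close> on the integral becomes \<open>e\<close> after
    the root is taken.\<close>
  have "0 < e powr r"
    using \<open>0 < e\<close> by simp
  then obtain d :: real where "0 < d" and d:
    "\<And>u v. u < ennreal d \<Longrightarrow> v < ennreal d \<Longrightarrow> ennreal ((2 * 1) powr r) * (u + v) < ennreal (e powr r)"
    using ex_small_error[of "e powr r" 1] by auto
  obtain l h where h: "h \<in> lc_fun p \<pi> l" "I (\<lambda>x. f x - h x) < ennreal d"
    using approx \<open>0 < d\<close> unfolding approximable_def by blast
  have [measurable]: "h \<in> borel_measurable \<mu>"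
    by (rule measurable_lc_fun[OF h(1)])
  \<comment> \<open>Chosen so that \<open>c powr r = d / 2\<close>: on a space of mass one a uniform
    error below \<open>c\<close> has integral at most \<open>d / 2\<close>.\<close>
  define c where "c = (d / 2) powr (1 / r)"
  have "Lp_norm \<rho> \<mu> (\<lambda>x. Y x - f x) < ennreal e"
    if [measurable]: "Y \<in> borel_measurable \<mu>" and Y: "\<And>x. \<bar>Y x - h x\<bar> < c" for Y
  proof -
    have "I (\<lambda>x. Y x - h x) \<le> (\<integral>\<^sup>+ x. ennreal (c powr r) \<partial>\<mu>)"
      using Y \<open>0 < r\<close> by (intro nn_integral_mono ennreal_leI powr_mono2) (auto intro: less_imp_le)
    also have "\<dots> = ennreal (d / 2)"
      using \<open>0 < r\<close> \<open>0 < d\<close> by (simp add: space_eq emeasure_UNIV c_def powr_powr)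
    also have "\<dots> < ennreal d"
      using \<open>0 < d\<close> by (intro ennreal_lessI) auto
    finally have Yh: "I (\<lambda>x. Y x - h x) < ennreal d" .
    have "I (\<lambda>x. Y x - f x) \<le> ennreal ((2 * 1) powr r) * (I (\<lambda>x. Y x - h x) + I (\<lambda>x. f x - h x))"
      by (rule I_Lipschitz) auto
    also have "\<dots> < ennreal (e powr r)"
      by (rule d[OF Yh h(2)])
    finally have *: "I (\<lambda>x. Y x - f x) < ennreal (e powr r)" .
    then have fin: "I (\<lambda>x. Y x - f x) \<noteq> \<infinity>"
      by auto
    have "enn2real (I (\<lambda>x. Y x - f x)) < e powr r"
      using * by (metis enn2real_less_iff enn2real_nonneg ennreal_enn2real_if ennreal_less_iff fin infinity_ennreal_def)
    then have "enn2real (I (\<lambda>x. Y x - f x)) powr (1 / r) < (e powr r) powr (1 / r)"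
      using \<open>0 < r\<close> by (intro powr_less_mono2) auto
    also have "\<dots> = e"
      using \<open>0 < r\<close> \<open>0 < e\<close> by (simp add: powr_powr)
    finally show ?thesis
      using fin False \<open>0 < e\<close> by (simp add: Lp_norm_def r_def Let_def ennreal_lessI)
  qed
  moreover have "0 < c"
    using \<open>0 < d\<close> by (simp add: c_def)
  ultimately show ?thesis
    using h(1) by (intro exI[of _ c] conjI exI[of _ l] bexI[of _ h]) auto
qed

section \<open>Networks with small weights\<close>

text \<open>A state is either the input or a value of \<open>s\<close>, so the bound is uniform in
  the weights, the biases and the depth.\<close>

lemma abs_dnn_state_le:
  assumes "\<And>t. \<bar>s t\<bar> \<le> B" "\<And>x. \<bar>X x\<bar> \<le> B"
  shows "\<bar>dnn_state p \<pi> s L w \<theta> X n x\<bar> \<le> B"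
  using assms by (cases n) auto

lemma dnn_output_approx_lc_fun:
  assumes range: "range \<sigma> = {-1<..<1}" and cont: "\<And>t. isCont \<sigma> t"
    and X: "X \<in> lc_fun p \<pi> L" and h: "h \<in> lc_fun p \<pi> (L + Suc n)" and "0 < e"
  obtains K \<theta>0 d where "1 < K" "\<theta>0 \<in> lc_fun p \<pi> (L + Suc n)" "0 < d"
    "\<And>w \<theta> x. (\<And>z. \<bar>w z\<bar> < d) \<Longrightarrow> (\<And>x. \<bar>\<theta> x - \<theta>0 x\<bar> < d) \<Longrightarrow>
       \<bar>dnn_output p \<pi> (\<lambda>t. K * \<sigma> t) L (Suc n) w \<theta> X x - h x\<bar> < e"
proof -
  define D where "D = digit_sums p \<pi> (L + Suc n)"
  have "finite D"
    unfolding D_def by (rule finite_digit_sums)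
  have "D \<noteq> {}"
    unfolding D_def using representative_mem by blast
  obtain C where C: "\<And>x. \<bar>h x\<bar> \<le> C"
    using finite_imp_bounded[OF finite_range_lc_fun[OF h]] by (auto simp: bounded_iff)
  obtain C' where C': "\<And>x. \<bar>X x\<bar> \<le> C'"
    using finite_imp_bounded[OF finite_range_lc_fun[OF X]] by (auto simp: bounded_iff)
  have "0 \<le> C" "0 \<le> C'"
    using C[of 0] C'[of 0] by auto
  \<comment> \<open>The scale exceeds every \<open>\<bar>h x\<bar>\<close>, which puts
    \<open>h x / K\<close> strictly inside the range of \<open>\<sigma>\<close>; the summand 2 also
    ensures \<open>1 < K\<close> when \<open>h\<close> vanishes.\<close>
  define K where "K = C + 2"
  have "1 < K"
    using \<open>0 \<le> C\<close> by (simp add: K_def)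
  \<comment> \<open>The preimage depends on \<open>x\<close> through \<open>h x\<close> only, so
    \<open>\<theta>0\<close> is constant on the same balls as \<open>h\<close>.\<close>
  define \<theta>0 where "\<theta>0 x = inv_into UNIV \<sigma> (h x / K)" for x
  have \<theta>0_lc: "\<theta>0 \<in> lc_fun p \<pi> (L + Suc n)"
    using h by (simp add: mem_lc_fun_iff \<theta>0_def)
  have \<theta>0: "K * \<sigma> (\<theta>0 x) = h x" for x
  proof -
    have "\<bar>h x\<bar> < K"
      using C[of x] by (simp add: K_def)
    then have "h x / K \<in> range \<sigma>"
      using \<open>1 < K\<close> by (auto simp: range field_simps abs_less_iff)
    then have "\<sigma> (\<theta>0 x) = h x / K"
      by (simp add: \<theta>0_def f_inv_into_f)
    then show ?thesis
      using \<open>1 < K\<close> by simp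
  qed
  have "\<exists>\<eta>>0. \<forall>u. \<bar>u - \<theta>0 j\<bar> < \<eta> \<longrightarrow> \<bar>K * \<sigma> u - h j\<bar> < e" for j
  proof -
    have "isCont (\<lambda>u. K * \<sigma> u) (\<theta>0 j)"
      using cont by (intro continuous_intros)
    then show ?thesis
      using \<open>0 < e\<close> \<theta>0[of j] by (auto simp: continuous_at_eps_delta dist_real_def)
  qed
  then obtain \<eta> where \<eta>: "\<And>j. 0 < \<eta> j"
      "\<And>j u. \<bar>u - \<theta>0 j\<bar> < \<eta> j \<Longrightarrow> \<bar>K * \<sigma> u - h j\<bar> < e"
    by metis
  \<comment> \<open>The output is read only at representatives, so continuity of
    \<open>\<sigma>\<close> at finitely many points suffices and the minimum of their moduli is
    positive.\<close>
  define m where "m = Min (\<eta> ` D)"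
  have "0 < m"
    unfolding m_def using \<open>finite D\<close> \<open>D \<noteq> {}\<close> \<eta>(1) by simp
  define B where "B = max K C'"
  have "0 < B"
    using \<open>1 < K\<close> by (simp add: B_def)
  \<comment> \<open>Solves \<open>(card D * B + 1) * d = m\<close>: the weighted sum contributes at
    most \<open>card D * B * d\<close> to the shift of the argument, the bias less than
    \<open>d\<close>.\<close>
  define d where "d = m / (card D * B + 1)"
  have pos: "0 < card D * B + 1"
    using \<open>0 < B\<close> by (simp add: add_nonneg_pos)
  have "0 < d"
    unfolding d_def using \<open>0 < m\<close> pos by simp
  have close: "\<bar>dnn_output p \<pi> (\<lambda>t. K * \<sigma> t) L (Suc n) w \<theta> X x - h x\<bar> < e"
    if w: "\<And>z. \<bar>w z\<bar> < d" and \<theta>: "\<And>x. \<bar>\<theta> x - \<theta>0 x\<bar> < d" for w \<theta> x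
  proof -
    define j where "j = representative p \<pi> (L + Suc n) x"
    define Z where "Z k = dnn_state p \<pi> (\<lambda>t. K * \<sigma> t) L w \<theta> X n (representative p \<pi> (L + n) k)" for k
    have "\<bar>K * \<sigma> t\<bar> \<le> B" for t
    proof -
      have "\<sigma> t \<in> {-1<..<1}"
        using range by blast
      then have "\<bar>\<sigma> t\<bar> \<le> 1"
        by auto
      then have "K * \<bar>\<sigma> t\<bar> \<le> K * 1"
        using \<open>1 < K\<close> by (intro mult_left_mono) auto
      moreover have "\<bar>K * \<sigma> t\<bar> = K * \<bar>\<sigma> t\<bar>" "K \<le> B"
        using \<open>1 < K\<close> by (simp_all add: abs_mult B_def)
      ultimately show ?thesis
        by linarith
    qed
    moreover have "\<bar>X x\<bar> \<le> B" for x
      using C'[of x] by (simp add: B_def)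
    ultimately have Z: "\<bar>Z k\<bar> \<le> B" for k
      unfolding Z_def by (intro abs_dnn_state_le)
    have "\<bar>\<Sum>k\<in>D. w (j, k) * Z k\<bar> \<le> (\<Sum>k\<in>D. d * B)"
      using w Z \<open>0 < d\<close>
      by (intro order_trans[OF sum_abs] sum_mono) (auto simp: abs_mult less_imp_le intro!: mult_mono)
    then have "\<bar>\<Sum>k\<in>D. w (j, k) * Z k\<bar> \<le> card D * B * d"
      by (simp add: ac_simps)
    then have "\<bar>(\<Sum>k\<in>D. w (j, k) * Z k) + \<theta> j - \<theta>0 j\<bar> < card D * B * d + d"
      using \<theta>[of j] by linarith
    also have "\<dots> = (card D * B + 1) * d"
      by (simp add: distrib_right)
    also have "\<dots> = m"
      unfolding d_def using pos by simp
    also have "m \<le> \<eta> j"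
      unfolding m_def j_def D_def using finite_digit_sums representative_mem by (intro Min_le) auto
    finally have "\<bar>K * \<sigma> ((\<Sum>k\<in>D. w (j, k) * Z k) + \<theta> j) - h j\<bar> < e"
      by (rule \<eta>(2))
    moreover have "h j = h x"
      unfolding j_def by (rule lc_fun_representative[OF h])
    ultimately show ?thesis
      by (simp add: dnn_output_def j_def Z_def D_def)
  qed
  show thesis
    by (rule that[OF \<open>1 < K\<close> \<theta>0_lc \<open>0 < d\<close> close])
qed

lemma dnn_output_mem_lc_fun: "dnn_output p \<pi> s L \<Delta> w \<theta> X \<in> lc_fun p \<pi> (L + \<Delta>)"
  unfolding dnn_output_def by (rule comp_representative_mem_lc_fun)

lemma dnn_output_approx_Lp:
  assumes "range \<sigma> = {-1<..<1}" "\<And>t. isCont \<sigma> t" "X \<in> lc_fun p \<pi> L"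
    and sets_eq: "sets \<mu> = sets borel" and "emeasure \<mu> UNIV = 1"
    and "1 \<le> \<rho>" "f \<in> Lp_space \<rho> \<mu>"
    and "\<rho> = \<infinity> \<Longrightarrow> \<exists>g. continuous_on UNIV g \<and> (AE x in \<mu>. f x = g x)" and "0 < e"
  shows "\<exists>\<Delta> K \<theta>0 d. 1 \<le> \<Delta> \<and> 1 < K \<and> \<theta>0 \<in> lc_fun p \<pi> (L + \<Delta>) \<and> 0 < d \<and>
           (\<forall>w \<theta>. (\<forall>z. \<bar>w z\<bar> < d) \<longrightarrow> (\<forall>x. \<bar>\<theta> x - \<theta>0 x\<bar> < d) \<longrightarrow>
              Lp_norm \<rho> \<mu> (\<lambda>x. dnn_output p \<pi> (\<lambda>t. K * \<sigma> t) L \<Delta> w \<theta> X x - f x) < ennreal e)"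
proof -
  obtain c l h where "0 < c" "h \<in> lc_fun p \<pi> l" and c: "\<And>Y. Y \<in> borel_measurable \<mu> \<Longrightarrow>
      (\<And>x. \<bar>Y x - h x\<bar> < c) \<Longrightarrow> Lp_norm \<rho> \<mu> (\<lambda>x. Y x - f x) < ennreal e"
    using Lp_norm_approx_lc_fun[OF assms(4-9)] by blast
  \<comment> \<open>\<open>Suc l\<close> layers put the output level above \<open>l\<close>,
    whatever \<open>L\<close> is, and guarantee that there is a last layer.\<close>
  have "h \<in> lc_fun p \<pi> (L + Suc l)"
    by (rule lc_fun_mono[OF _ \<open>h \<in> lc_fun p \<pi> l\<close>]) simp
  from dnn_output_approx_lc_fun[OF assms(1-3) this \<open>0 < c\<close>]
  obtain K \<theta>0 d where "1 < K" "\<theta>0 \<in> lc_fun p \<pi> (L + Suc l)" "0 < d" and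
    d: "\<And>w \<theta> x. (\<And>z. \<bar>w z\<bar> < d) \<Longrightarrow> (\<And>x. \<bar>\<theta> x - \<theta>0 x\<bar> < d) \<Longrightarrow>
       \<bar>dnn_output p \<pi> (\<lambda>t. K * \<sigma> t) L (Suc l) w \<theta> X x - h x\<bar> < c"
    by metis
  moreover have "Lp_norm \<rho> \<mu> (\<lambda>x. dnn_output p \<pi> (\<lambda>t. K * \<sigma> t) L (Suc l) w \<theta> X x - f x) < ennreal e"
    if "\<forall>z. \<bar>w z\<bar> < d" "\<forall>x. \<bar>\<theta> x - \<theta>0 x\<bar> < d" for w \<theta>
    using that by (intro c d borel_measurable_lc_fun[OF sets_eq dnn_output_mem_lc_fun]) auto
  ultimately show ?thesis
    by (intro exI[of _ "Suc l"] exI[of _ K] exI[of _ \<theta>0] exI[of _ d]) auto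
qed

section \<open>Products of networks and balls of parameters\<close>

lemma sup_norm_tuple_lessD:
  assumes "sup_norm_tuple R \<phi> < r" "i \<in> {1..R}" "finite (range (\<phi> i))"
  shows "\<bar>\<phi> i x\<bar> < r"
proof -
  have "(SUP x. \<bar>\<phi> i x\<bar>) \<le> sup_norm_tuple R \<phi>"
    unfolding sup_norm_tuple_def using assms(2) by (intro Max_ge) auto
  moreover have "finite (range (\<lambda>x. \<bar>\<phi> i x\<bar>))"
    using finite_imageI[OF assms(3), of abs] by (simp add: image_image)
  then have "\<bar>\<phi> i x\<bar> \<le> (SUP x. \<bar>\<phi> i x\<bar>)"
    by (intro cSUP_upper bdd_above_finite) auto
  ultimately show ?thesis
    using assms(1) by linarith
qed

theorem dnn_product_approx_Lp:
  assumes range: "range \<sigma> = {-1<..<1}" and cont: "\<And>t. isCont \<sigma> t"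
    and \<rho>: "1 \<le> \<rho>" and R: "1 \<le> R" and "0 < \<epsilon>"
    and \<mu>: "normalized_haar \<mu>" and f: "\<forall>i\<in>{1..R}. f i \<in> Lp_space \<rho> \<mu>"
    and f_inf: "\<rho> = \<infinity> \<longrightarrow> (\<forall>i\<in>{1..R}. \<exists>g. continuous_on UNIV g \<and> (AE x in \<mu>. f i x = g x))"
    and X: "X \<in> (\<Pi> i\<in>{1..R}. lc_fun p \<pi> (L i))"
  shows "\<exists>\<Delta> Ms w0 \<theta>0 r s.
          (\<forall>i\<in>{1..R}. 1 \<le> \<Delta> i \<and> 1 < Ms i) \<and>
          w0 \<in> (\<Pi> i\<in>{1..R}. lc_fun2 p \<pi> (L i + \<Delta> i)) \<and>
          \<theta>0 \<in> (\<Pi> i\<in>{1..R}. lc_fun p \<pi> (L i + \<Delta> i)) \<and>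
          0 < r \<and> 0 < s \<and>
          (\<forall>w \<in> direct_sum_ball R (\<lambda>i. lc_fun2 p \<pi> (L i + \<Delta> i)) w0 r.
           \<forall>\<theta> \<in> direct_sum_ball R (\<lambda>i. lc_fun p \<pi> (L i + \<Delta> i)) \<theta>0 s.
             let Y = dnn_product_output p \<pi> (\<lambda>i t. Ms i * \<sigma> t) L \<Delta> w \<theta> X
             in Y \<in> (\<Pi> i\<in>{1..R}. lc_fun p \<pi> (L i + \<Delta> i)) \<and>
                Lp_norm_tuple R \<rho> \<mu> (\<lambda>i x. Y i x - f i x) < ennreal \<epsilon>)"
proof -
  have \<mu>': "sets \<mu> = sets borel" "emeasure \<mu> UNIV = 1"
    using \<mu> by (auto simp: normalized_haar_def)
  define P where "P i \<Delta> K \<theta>0 d \<longleftrightarrow>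
      1 \<le> \<Delta> \<and> 1 < K \<and> \<theta>0 \<in> lc_fun p \<pi> (L i + \<Delta>) \<and> 0 < d \<and>
      (\<forall>w \<theta>. (\<forall>z. \<bar>w z\<bar> < d) \<longrightarrow> (\<forall>x. \<bar>\<theta> x - \<theta>0 x\<bar> < d) \<longrightarrow>
         Lp_norm \<rho> \<mu> (\<lambda>x. dnn_output p \<pi> (\<lambda>t. K * \<sigma> t) (L i) \<Delta> w \<theta> (X i) x - f i x) < ennreal \<epsilon>)"
    for i \<Delta> K \<theta>0 d
  have "\<exists>\<Delta> K \<theta>0 d. P i \<Delta> K \<theta>0 d" if "i \<in> {1..R}" for i
    unfolding P_def
    by (rule dnn_output_approx_Lp[OF range cont _ \<mu>' \<rho> _ _ \<open>0 < \<epsilon>\<close>]) (use that X f f_inf in auto)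
  then obtain \<Delta> K \<theta>0 d where P: "\<And>i. i \<in> {1..R} \<Longrightarrow> P i (\<Delta> i) (K i) (\<theta>0 i) (d i)"
    by metis
  then have *: "1 \<le> \<Delta> i" "1 < K i" "\<theta>0 i \<in> lc_fun p \<pi> (L i + \<Delta> i)" "0 < d i" if "i \<in> {1..R}" for i
    using that by (auto simp: P_def)
  have close: "Lp_norm \<rho> \<mu> (\<lambda>x. dnn_output p \<pi> (\<lambda>t. K i * \<sigma> t) (L i) (\<Delta> i) w \<theta> (X i) x - f i x) < ennreal \<epsilon>"
    if "i \<in> {1..R}" "\<And>z. \<bar>w z\<bar> < d i" "\<And>x. \<bar>\<theta> x - \<theta>0 i x\<bar> < d i" for i w \<theta>
    using P[OF that(1)] that(2,3) unfolding P_def by blast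
  \<comment> \<open>The smallest of the tolerances of the components serves as radius for the
    weights and for the biases, because the direct sum carries the maximum norm.\<close>
  define r where "r = Min (d ` {1..R})"
  have "0 < r"
    unfolding r_def using R *(4) by simp
  have r_le: "r \<le> d i" if "i \<in> {1..R}" for i
    unfolding r_def using that by (intro Min_le) auto
  show ?thesis
    unfolding Let_def
  proof (intro exI[of _ \<Delta>] exI[of _ K] exI[of _ "\<lambda>_ (_ :: 'a \<times> 'a). 0"] exI[of _ \<theta>0] exI[of _ r] conjI ballI)
    fix w \<theta>
    assume w: "w \<in> direct_sum_ball R (\<lambda>i. lc_fun2 p \<pi> (L i + \<Delta> i)) (\<lambda>_ _. 0) r"
      and \<theta>: "\<theta> \<in> direct_sum_ball R (\<lambda>i. lc_fun p \<pi> (L i + \<Delta> i)) \<theta>0 r"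
    let ?Y = "dnn_product_output p \<pi> (\<lambda>i t. K i * \<sigma> t) L \<Delta> w \<theta> X"
    show "?Y \<in> (\<Pi> i\<in>{1..R}. lc_fun p \<pi> (L i + \<Delta> i))"
      unfolding dnn_product_output_def using dnn_output_mem_lc_fun by (simp add: Pi_iff)
    have "Lp_norm \<rho> \<mu> (\<lambda>x. ?Y i x - f i x) < ennreal \<epsilon>" if i: "i \<in> {1..R}" for i
      unfolding dnn_product_output_def
    proof (rule close[OF i])
      have "finite (range (w i))"
        using w i by (intro finite_range_lc_fun2) (auto simp: direct_sum_ball_def)
      then have "\<bar>w i z\<bar> < r" for z
        using w i by (intro sup_norm_tuple_lessD[of R w]) (auto simp: direct_sum_ball_def)
      then show "\<bar>w i z\<bar> < d i" for z
        using r_le[OF i] by (rule less_le_trans)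
      have "\<theta> i \<in> lc_fun p \<pi> (L i + \<Delta> i)"
        using \<theta> i by (auto simp: direct_sum_ball_def)
      then have "(\<lambda>x. \<theta> i x - \<theta>0 i x) \<in> lc_fun p \<pi> (L i + \<Delta> i)"
        using *(3)[OF i] by (simp add: mem_lc_fun_iff)
      then have "finite (range (\<lambda>x. \<theta> i x - \<theta>0 i x))"
        by (rule finite_range_lc_fun)
      then have "\<bar>\<theta> i x - \<theta>0 i x\<bar> < r" for x
        using \<theta> i sup_norm_tuple_lessD[of R "\<lambda>i x. \<theta> i x - \<theta>0 i x" r i x]
        by (simp add: direct_sum_ball_def)
      then show "\<bar>\<theta> i x - \<theta>0 i x\<bar> < d i" for x
        using r_le[OF i] by (rule less_le_trans)
    qed
    then show "Lp_norm_tuple R \<rho> \<mu> (\<lambda>i x. ?Y i x - f i x) < ennreal \<epsilon>"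
      unfolding Lp_norm_tuple_def using R by (subst Max_less_iff) auto
  qed (use * \<open>0 < r\<close> in \<open>auto simp: lc_fun2_def\<close>)
qed

end

section \<open>The ring of p-adic integers\<close>

lemma digit_sums_0: "digit_sums p \<pi> 0 = {0}"
  by (auto simp: digit_sums_def)

lemma digit_sums_Suc:
  "digit_sums p \<pi> (Suc l) = {x + of_nat d * \<pi> ^ l |x d. x \<in> digit_sums p \<pi> l \<and> d < p}"
proof safe
  fix x assume "x \<in> digit_sums p \<pi> (Suc l)"
  then obtain d where "x = (\<Sum>j<Suc l. of_nat (d j) * \<pi> ^ j)" "\<forall>j<Suc l. d j < p"
    by (auto simp: digit_sums_def)
  then show "\<exists>x' c. x = x' + of_nat c * \<pi> ^ l \<and> x' \<in> digit_sums p \<pi> l \<and> c < p"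
    by (intro exI[of _ "\<Sum>j<l. of_nat (d j) * \<pi> ^ j"] exI[of _ "d l"]) (auto simp: digit_sums_def)
next
  fix x c assume "x \<in> digit_sums p \<pi> l" "c < p"
  then obtain d where "x = (\<Sum>j<l. of_nat (d j) * \<pi> ^ j)" "\<forall>j<l. d j < p"
    by (auto simp: digit_sums_def)
  with \<open>c < p\<close> show "x + of_nat c * \<pi> ^ l \<in> digit_sums p \<pi> (Suc l)"
    unfolding digit_sums_def
    by (intro CollectI exI[of _ "d(l := c)"]) (auto simp: less_Suc_eq intro!: sum.cong)
qed

text \<open>Expansion in base \<open>p\<close>: in the step, the new top digit is the quotient by
  \<open>p ^ l\<close> and the earlier digits encode the remainder.\<close>

lemma digit_sums_of_nat: "digit_sums p (of_nat p) l = of_nat ` {..<p ^ l}"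
proof (induction l)
  case 0
  then show ?case
    by (simp add: digit_sums_0 lessThan_Suc)
next
  case (Suc l)
  show ?case
  proof safe
    fix x :: 'a assume "x \<in> digit_sums p (of_nat p) (Suc l)"
    then obtain k d where "x = of_nat k + of_nat d * of_nat p ^ l" "k < p ^ l" "d < p"
      unfolding digit_sums_Suc Suc.IH by auto
    moreover from this have "k + d * p ^ l < Suc d * p ^ l"
      by simp
    then have "k + d * p ^ l < p ^ Suc l"
      using mult_le_mono1[of "Suc d" p "p ^ l"] \<open>d < p\<close> by (simp only: power_Suc) linarith
    ultimately show "x \<in> of_nat ` {..<p ^ Suc l}"
      by (intro image_eqI[of _ _ "k + d * p ^ l"]) auto
  next
    fix k assume k: "k < p ^ Suc l"
    then have "0 < p ^ l"
      by (cases "p = 0") auto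
    have "k div p ^ l < p"
      using k by (intro less_mult_imp_div_less) simp
    moreover have "(of_nat k :: 'a) = of_nat (k mod p ^ l) + of_nat (k div p ^ l) * of_nat p ^ l"
      by (metis mod_mult_div_eq mult.commute of_nat_add of_nat_mult of_nat_power)
    moreover have "k mod p ^ l < p ^ l"
      using \<open>0 < p ^ l\<close> by simp
    ultimately show "of_nat k \<in> digit_sums p (of_nat p :: 'a) (Suc l)"
      unfolding digit_sums_Suc Suc.IH by blast
  qed
qed

lemma Rep_padic_int_bounds:
  fixes x :: "'p :: prime_card padic_int"
  shows "0 \<le> Rep_padic_int x n" "Rep_padic_int x n < int CARD('p) ^ n"
  using Rep_padic_int[of x] by auto

lemma Rep_padic_int_mod:
  fixes x :: "'p :: prime_card padic_int"
  assumes "m \<le> n"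
  shows "Rep_padic_int x n mod int CARD('p) ^ m = Rep_padic_int x m"
  using assms
proof (induction n rule: dec_induct)
  case base
  show ?case
    using Rep_padic_int_bounds[of x m] by simp
next
  case (step n)
  have "Rep_padic_int x (Suc n) mod int CARD('p) ^ n = Rep_padic_int x n"
    using Rep_padic_int[of x] by auto
  then show ?case
    using step mod_mod_cancel[OF le_imp_power_dvd[OF step(1)], of "Rep_padic_int x (Suc n)" "int CARD('p)"]
    by simp
qed

lemma Rep_padic_int_of_nat:
  "Rep_padic_int (of_nat k :: 'p :: prime_card padic_int) n = int k mod int CARD('p) ^ n"
proof (induction k)
  case (Suc k)
  then show ?case
    by (simp add: plus_padic_int.rep_eq one_padic_int.rep_eq mod_simps)
qed (simp add: zero_padic_int.rep_eq)

text \<open>If the residue at level \<open>l\<close> vanishes, all later residues are divisible by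
  \<open>p ^ l\<close>, and their quotients form a coherent sequence.\<close>

lemma of_nat_card_power_dvd_padic_int_iff:
  fixes x :: "'p :: prime_card padic_int"
  shows "of_nat CARD('p) ^ l dvd x \<longleftrightarrow> Rep_padic_int x l = 0"
proof
  let ?q = "int CARD('p)"
  have rep: "Rep_padic_int (of_nat CARD('p) ^ l * y) n = ?q ^ l * Rep_padic_int y n mod ?q ^ n"
    for y :: "'p padic_int" and n
  proof -
    have "of_nat CARD('p) ^ l = (of_nat (CARD('p) ^ l) :: 'p padic_int)"
      by simp
    then show ?thesis
      by (simp only: times_padic_int.rep_eq Rep_padic_int_of_nat) (simp add: mod_simps)
  qed
  show "Rep_padic_int x l = 0" if "of_nat CARD('p) ^ l dvd x"
    using that rep by (auto elim!: dvdE)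
  assume 0: "Rep_padic_int x l = 0"
  have q: "0 < ?q"
    by simp
  have dvd: "?q ^ l dvd Rep_padic_int x (n + l)" for n
    using Rep_padic_int_mod[of l "n + l" x] 0 by (simp add: mod_eq_0_iff_dvd)
  \<comment> \<open>Dividing by \<open>p ^ l\<close> costs \<open>l\<close> levels of precision,
    hence the shifted index.\<close>
  define z where "z n = Rep_padic_int x (n + l) div ?q ^ l" for n
  have zl: "?q ^ l * z n = Rep_padic_int x (n + l)" for n
    unfolding z_def using dvd by simp
  have "z n \<in> {0..<?q ^ n} \<and> z (Suc n) mod ?q ^ n = z n" for n
  proof (intro conjI)
    have "?q ^ l * z n < ?q ^ l * ?q ^ n" "0 \<le> ?q ^ l * z n"
      using Rep_padic_int_bounds[of x "n + l"] unfolding zl by (simp_all add: power_add mult.commute)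
    then show "z n \<in> {0..<?q ^ n}"
      using zero_less_power[OF q, of l] by (simp add: zero_le_mult_iff)
    have "?q ^ l * (z (Suc n) mod ?q ^ n) = Rep_padic_int x (Suc n + l) mod ?q ^ (n + l)"
      by (simp only: zl[of "Suc n", symmetric] mult_mod_right power_add mult.commute[of "?q ^ n"])
    also have "\<dots> = ?q ^ l * z n"
      unfolding zl by (rule Rep_padic_int_mod) simp
    finally show "z (Suc n) mod ?q ^ n = z n"
      using q by simp
  qed
  then have z: "Rep_padic_int (Abs_padic_int z :: 'p padic_int) = z"
    by (intro Abs_padic_int_inverse) simp
  have "x = of_nat CARD('p) ^ l * Abs_padic_int z"
    unfolding Rep_padic_int_inject[symmetric]
    by (rule ext) (simp add: rep z zl Rep_padic_int_mod)
  then show "of_nat CARD('p) ^ l dvd x"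
    by simp
qed

lemma mem_adic_ball_padic_int_iff:
  fixes x y :: "'p :: prime_card padic_int"
  shows "y \<in> adic_ball (of_nat CARD('p)) l x \<longleftrightarrow> Rep_padic_int y l = Rep_padic_int x l"
proof -
  have "Rep_padic_int (y - x) l = 0 \<longleftrightarrow>
      Rep_padic_int y l mod int CARD('p) ^ l = Rep_padic_int x l mod int CARD('p) ^ l"
    by (simp only: minus_padic_int.rep_eq mod_eq_dvd_iff mod_eq_0_iff_dvd)
  then show ?thesis
    by (simp add: mem_adic_ball_iff_dvd of_nat_card_power_dvd_padic_int_iff Rep_padic_int_mod)
qed

text \<open>Adic balls are the closed metric balls of radius \<open>p ^ (- l)\<close>. This connects
  them with the topology, which is defined by the metric.\<close>

lemma mem_adic_ball_padic_int_iff_dist: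
  fixes x y :: "'p :: prime_card padic_int"
  shows "y \<in> adic_ball (of_nat CARD('p)) l x \<longleftrightarrow> dist y x \<le> inverse (real CARD('p) ^ l)"
proof (cases "x = y")
  case True
  then show ?thesis
    by (simp add: self_mem_adic_ball)
next
  case False
  have p: "1 < real CARD('p)"
    using card_prime_card_gt_1[where 'p = 'p] by simp
  have "Rep_padic_int y l = Rep_padic_int x l \<longleftrightarrow> l \<le> padic_agree y x"
  proof
    assume eq: "Rep_padic_int y l = Rep_padic_int x l"
    show "l \<le> padic_agree y x"
    proof (rule ccontr)
      assume "\<not> ?thesis"
      then have le: "Suc (padic_agree y x) \<le> l"
        by simp
      have "Rep_padic_int y (Suc (padic_agree y x)) = Rep_padic_int x (Suc (padic_agree y x))"
        using Rep_padic_int_mod[OF le, of y] Rep_padic_int_mod[OF le, of x] unfolding eq by simp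
      then show False
        using padic_agree_neq[of y x] False by simp
    qed
  next
    assume "l \<le> padic_agree y x"
    \<comment> \<open>The index shift in \<open>padic_agree\<close> leaves \<open>l = 0\<close>
      apart; there both residues are 0 by the bounds.\<close>
    then show "Rep_padic_int y l = Rep_padic_int x l"
      using padic_agree_eq[of "l - 1" y x] Rep_padic_int_bounds[of y 0] Rep_padic_int_bounds[of x 0]
      by (cases l) auto
  qed
  also have "\<dots> \<longleftrightarrow> inverse (real CARD('p) ^ padic_agree y x) \<le> inverse (real CARD('p) ^ l)"
    using p by (simp add: power_increasing_iff)
  finally show ?thesis
    using False by (simp add: mem_adic_ball_padic_int_iff dist_padic_int_def)
qed

interpretation padic: adic_ring "CARD('p)" "of_nat CARD('p) :: 'p :: prime_card padic_int"
proof
  fix l and x :: "'p padic_int"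
  show "\<exists>!i. i \<in> digit_sums CARD('p) (of_nat CARD('p)) l \<and> x \<in> adic_ball (of_nat CARD('p)) l i"
  proof
    let ?k = "nat (Rep_padic_int x l)"
    have "?k < CARD('p) ^ l"
      using Rep_padic_int_bounds[of x l] by (simp add: nat_less_iff)
    moreover have "Rep_padic_int x l = Rep_padic_int (of_nat ?k :: 'p padic_int) l"
      using Rep_padic_int_bounds[of x l] by (simp only: Rep_padic_int_of_nat) simp
    ultimately show "of_nat ?k \<in> digit_sums CARD('p) (of_nat CARD('p) :: 'p padic_int) l \<and>
        x \<in> adic_ball (of_nat CARD('p)) l (of_nat ?k)"
      unfolding digit_sums_of_nat mem_adic_ball_padic_int_iff by blast
  next
    fix i assume i: "i \<in> digit_sums CARD('p) (of_nat CARD('p)) l \<and> x \<in> adic_ball (of_nat CARD('p)) l i"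
    then obtain k where k: "k < CARD('p) ^ l" "i = of_nat k"
      unfolding digit_sums_of_nat by auto
    have "int k < int CARD('p) ^ l"
      using k(1) by (metis of_nat_less_iff of_nat_power)
    then have "Rep_padic_int x l = int k"
      using i k unfolding mem_adic_ball_padic_int_iff by (simp add: Rep_padic_int_of_nat)
    then show "i = of_nat (nat (Rep_padic_int x l))"
      using k by simp
  qed
next
  fix U :: "'p padic_int set"
  have p: "1 < real CARD('p)"
    using card_prime_card_gt_1[where 'p = 'p] by simp
  have "(\<exists>e>0. \<forall>y. dist y x < e \<longrightarrow> y \<in> U) \<longleftrightarrow> (\<exists>l. adic_ball (of_nat CARD('p)) l x \<subseteq> U)" for x
  proof
    assume "\<exists>e>0. \<forall>y. dist y x < e \<longrightarrow> y \<in> U"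
    then obtain e where e: "0 < e" "\<And>y. dist y x < e \<Longrightarrow> y \<in> U"
      by blast
    obtain l where "inverse (real CARD('p)) ^ l < e"
      using real_arch_pow_inv[OF e(1), of "inverse (real CARD('p))"] p by (auto simp: field_simps)
    then have "inverse (real CARD('p) ^ l) < e"
      by (simp only: power_inverse)
    then show "\<exists>l. adic_ball (of_nat CARD('p)) l x \<subseteq> U"
      by (intro exI[of _ l]) (auto simp: mem_adic_ball_padic_int_iff_dist intro!: e(2))
  next
    assume "\<exists>l. adic_ball (of_nat CARD('p)) l x \<subseteq> U"
    then obtain l where l: "adic_ball (of_nat CARD('p)) l x \<subseteq> U"
      by blast
    then have "y \<in> U" if "dist y x < inverse (real CARD('p) ^ l)" for y
      using that mem_adic_ball_padic_int_iff_dist[of y l x] by auto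
    then show "\<exists>e>0. \<forall>y. dist y x < e \<longrightarrow> y \<in> U"
      using p by (intro exI[of _ "inverse (real CARD('p) ^ l)"]) auto
  qed
  then show "open U \<longleftrightarrow> (\<forall>x\<in>U. \<exists>l. adic_ball (of_nat CARD('p)) l x \<subseteq> U)"
    by (simp only: open_dist)
next
  fix a :: "nat \<Rightarrow> 'p padic_int"
  assume "\<And>n. a (Suc n) \<in> adic_ball (of_nat CARD('p)) n (a n)"
  then have a: "Rep_padic_int (a (Suc n)) n = Rep_padic_int (a n) n" for n
    by (simp add: mem_adic_ball_padic_int_iff)
  \<comment> \<open>The limit is diagonal: \<open>a (Suc n)\<close> has the same residue as
    \<open>a n\<close> at level \<open>n\<close>, so the diagonal residues are coherent.\<close>
  define z where "z n = Rep_padic_int (a n) n" for n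
  have "Rep_padic_int (Abs_padic_int z :: 'p padic_int) = z"
    using Rep_padic_int_bounds[where 'p = 'p] Rep_padic_int_mod[of n "Suc n" "a (Suc n)" for n] a
    by (intro Abs_padic_int_inverse) (simp add: z_def)
  then show "\<exists>x. \<forall>n. x \<in> adic_ball (of_nat CARD('p)) n (a n)"
    by (intro exI[of _ "Abs_padic_int z"]) (simp add: mem_adic_ball_padic_int_iff z_def)
qed

section \<open>The ring of power series over the prime field\<close>

lemma mem_adic_ball_fps_iff:
  fixes x y :: "'a :: comm_ring_1 fps"
  shows "y \<in> adic_ball fps_X l x \<longleftrightarrow> (\<forall>n<l. fps_nth y n = fps_nth x n)"
proof
  assume "y \<in> adic_ball fps_X l x"
  then obtain z where "y - x = fps_X ^ l * z"
    unfolding mem_adic_ball_iff_dvd by (auto elim!: dvdE)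
  then have "fps_nth (y - x) n = 0" if "n < l" for n
    using that by (simp add: fps_X_power_mult_nth)
  then show "\<forall>n<l. fps_nth y n = fps_nth x n"
    by simp
next
  assume *: "\<forall>n<l. fps_nth y n = fps_nth x n"
  have "y - x = fps_X ^ l * fps_shift l (y - x)"
    using * by (simp add: fps_eq_iff fps_X_power_mult_nth)
  then show "y \<in> adic_ball fps_X l x"
    unfolding mem_adic_ball_iff_dvd by (metis dvd_triv_left)
qed

text \<open>The metric on power series has base 2 rather than \<open>p\<close>; the topology is the
  adic one all the same.\<close>

lemma mem_adic_ball_fps_iff_dist:
  fixes x y :: "'a :: comm_ring_1 fps"
  shows "y \<in> adic_ball fps_X l x \<longleftrightarrow> dist y x \<le> inverse (2 ^ l)"
proof (cases "x = y")
  case True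
  then show ?thesis
    by (simp add: self_mem_adic_ball)
next
  case False
  have "(\<forall>n<l. fps_nth y n = fps_nth x n) \<longleftrightarrow> l \<le> subdegree (y - x)"
    using False subdegree_geI[of "y - x" l] nth_less_subdegree_zero[of _ "y - x"] by fastforce
  then show ?thesis
    using False by (simp add: mem_adic_ball_fps_iff dist_fps_def)
qed

text \<open>There are no carries: the digits appear directly as coefficients. This gives uniqueness
  of representatives for power series.\<close>

lemma fps_nth_digit_sum:
  "fps_nth (\<Sum>j<l. of_nat (d j) * fps_X ^ j) n = (if n < l then of_nat (d n) else (0 :: 'a :: comm_ring_1))"
proof -
  have "fps_nth (of_nat (d j) * fps_X ^ j :: 'a fps) n = (if n = j then of_nat (d j) else 0)" for j
    by (simp add: fps_mult_of_nat_nth)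
  then show ?thesis
    by (simp add: fps_sum_nth)
qed

interpretation power_series: adic_ring "CARD('p)" "fps_X :: 'p :: prime_card mod_ring fps"
proof
  fix l and x :: "'p mod_ring fps"
  \<comment> \<open>Picks a digit for each element of the prime field, all of whose elements are
    images of naturals below \<open>p\<close>.\<close>
  define c where "c a = (SOME i. i < CARD('p) \<and> a = of_nat i)" for a :: "'p mod_ring"
  have "c a < CARD('p) \<and> a = of_nat (c a)" for a
    unfolding c_def by (rule someI_ex) (rule surj_of_nat_mod_ring)
  then have c: "c a < CARD('p)" "of_nat (c a) = a" for a
    by (blast, metis)
  show "\<exists>!i. i \<in> digit_sums CARD('p) fps_X l \<and> x \<in> adic_ball fps_X l i"
  proof
    let ?i = "\<Sum>j<l. of_nat (c (fps_nth x j)) * fps_X ^ j :: 'p mod_ring fps"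
    show "?i \<in> digit_sums CARD('p) fps_X l \<and> x \<in> adic_ball fps_X l ?i"
    proof
      show "?i \<in> digit_sums CARD('p) fps_X l"
        using c unfolding digit_sums_def by (intro CollectI exI[of _ "\<lambda>j. c (fps_nth x j)"]) simp
      show "x \<in> adic_ball fps_X l ?i"
        by (simp add: mem_adic_ball_fps_iff fps_nth_digit_sum c)
    qed
    fix i assume i: "i \<in> digit_sums CARD('p) fps_X l \<and> x \<in> adic_ball fps_X l i"
    then obtain d where d: "i = (\<Sum>j<l. of_nat (d j) * fps_X ^ j)"
      unfolding digit_sums_def by blast
    show "i = ?i"
      using i by (simp add: mem_adic_ball_fps_iff d fps_eq_iff fps_nth_digit_sum c)
  qed
next
  fix U :: "'p mod_ring fps set"
  have "(\<exists>e>0. \<forall>y. dist y x < e \<longrightarrow> y \<in> U) \<longleftrightarrow> (\<exists>l. adic_ball fps_X l x \<subseteq> U)" for x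
  proof
    assume "\<exists>e>0. \<forall>y. dist y x < e \<longrightarrow> y \<in> U"
    then obtain e where e: "0 < e" "\<And>y. dist y x < e \<Longrightarrow> y \<in> U"
      by blast
    obtain l where "inverse 2 ^ l < e"
      using real_arch_pow_inv[OF e(1), of "inverse 2"] by auto
    then have "inverse (2 ^ l) < e"
      by (simp only: power_inverse)
    then show "\<exists>l. adic_ball fps_X l x \<subseteq> U"
      by (intro exI[of _ l]) (auto simp: mem_adic_ball_fps_iff_dist intro!: e(2))
  next
    assume "\<exists>l. adic_ball fps_X l x \<subseteq> U"
    then obtain l where l: "adic_ball fps_X l x \<subseteq> U"
      by blast
    then have "y \<in> U" if "dist y x < inverse (2 ^ l)" for y
      using that mem_adic_ball_fps_iff_dist[of y l x] by auto
    then show "\<exists>e>0. \<forall>y. dist y x < e \<longrightarrow> y \<in> U"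
      by (intro exI[of _ "inverse (2 ^ l)"]) auto
  qed
  then show "open U \<longleftrightarrow> (\<forall>x\<in>U. \<exists>l. adic_ball fps_X l x \<subseteq> U)"
    by (simp only: open_dist)
next
  fix a :: "nat \<Rightarrow> 'p mod_ring fps"
  assume "\<And>n. a (Suc n) \<in> adic_ball fps_X n (a n)"
  then have a: "fps_nth (a (Suc n)) k = fps_nth (a n) k" if "k < n" for n k
    using that unfolding mem_adic_ball_fps_iff by blast
  \<comment> \<open>The step from \<open>a n\<close> to \<open>a (Suc n)\<close> fixes the
    coefficients below \<open>n\<close>, so coefficient \<open>k\<close> is final from index
    \<open>Suc k\<close> on. The limit series takes it from there.\<close>
  have *: "fps_nth (a n) k = fps_nth (a (Suc k)) k" if "Suc k \<le> n" for n k
    using that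
  proof (induction n rule: dec_induct)
    case (step n)
    then show ?case
      using a[of k n] by simp
  qed simp
  show "\<exists>x. \<forall>n. x \<in> adic_ball fps_X n (a n)"
    unfolding mem_adic_ball_fps_iff
  proof (intro exI[of _ "Abs_fps (\<lambda>k. fps_nth (a (Suc k)) k)"] allI impI)
    fix n k :: nat assume "k < n"
    then show "fps_nth (Abs_fps (\<lambda>k. fps_nth (a (Suc k)) k)) k = fps_nth (a n) k"
      unfolding fps_nth_Abs_fps by (intro *[symmetric] Suc_leI)
  qed
qed

theorem corollary1:
  fixes \<sigma> :: "real \<Rightarrow> real" and \<rho> :: ennreal and R :: nat and M \<epsilon> :: real and L :: "nat \<Rightarrow> nat"
  assumes "range \<sigma> = {-1<..<1}" and "\<And>t. \<sigma> differentiable (at t)"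
    and "1 \<le> \<rho>" and "1 \<le> R" and "1 < M" and "0 < \<epsilon>"
    and "\<And>i. i \<in> {1..R} \<Longrightarrow> 1 \<le> L i"
  shows
    "(\<forall>(\<mu> :: ('p :: prime_card) padic_int measure) (f :: nat \<Rightarrow> ('p :: prime_card) padic_int \<Rightarrow> real) (X :: nat \<Rightarrow> ('p :: prime_card) padic_int \<Rightarrow> real).
       normalized_haar \<mu> \<longrightarrow>
       (\<forall>i\<in>{1..R}. f i \<in> Lp_space \<rho> \<mu>) \<longrightarrow>
       Lp_norm_tuple R \<rho> \<mu> f < ennreal M \<longrightarrow>
       (\<rho> = \<infinity> \<longrightarrow> (\<forall>i\<in>{1..R}. \<exists>g. continuous_on UNIV g \<and> (AE x in \<mu>. f i x = g x))) \<longrightarrow>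
       X \<in> (\<Pi> i\<in>{1..R}. lc_fun CARD('p) (of_nat CARD('p)) (L i)) \<longrightarrow>
       (\<exists>\<Delta> Ms w0 \<theta>0 r s.
          (\<forall>i\<in>{1..R}. 1 \<le> \<Delta> i \<and> 1 < Ms i) \<and>
          w0 \<in> (\<Pi> i\<in>{1..R}. lc_fun2 CARD('p) (of_nat CARD('p)) (L i + \<Delta> i)) \<and>
          \<theta>0 \<in> (\<Pi> i\<in>{1..R}. lc_fun CARD('p) (of_nat CARD('p)) (L i + \<Delta> i)) \<and>
          0 < r \<and> 0 < s \<and>
          (\<forall>w \<in> direct_sum_ball R (\<lambda>i. lc_fun2 CARD('p) (of_nat CARD('p)) (L i + \<Delta> i)) w0 r.
           \<forall>\<theta> \<in> direct_sum_ball R (\<lambda>i. lc_fun CARD('p) (of_nat CARD('p)) (L i + \<Delta> i)) \<theta>0 s.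
             let Y = dnn_product_output CARD('p) (of_nat CARD('p)) (\<lambda>i t. Ms i * \<sigma> t) L \<Delta> w \<theta> X
             in Y \<in> (\<Pi> i\<in>{1..R}. lc_fun CARD('p) (of_nat CARD('p)) (L i + \<Delta> i)) \<and>
                Lp_norm_tuple R \<rho> \<mu> (\<lambda>i x. Y i x - f i x) < ennreal \<epsilon>))) \<and>
     (\<forall>(\<mu> :: 'p mod_ring fps measure) (f :: nat \<Rightarrow> 'p mod_ring fps \<Rightarrow> real) (X :: nat \<Rightarrow> 'p mod_ring fps \<Rightarrow> real).
       normalized_haar \<mu> \<longrightarrow>
       (\<forall>i\<in>{1..R}. f i \<in> Lp_space \<rho> \<mu>) \<longrightarrow>
       Lp_norm_tuple R \<rho> \<mu> f < ennreal M \<longrightarrow>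
       (\<rho> = \<infinity> \<longrightarrow> (\<forall>i\<in>{1..R}. \<exists>g. continuous_on UNIV g \<and> (AE x in \<mu>. f i x = g x))) \<longrightarrow>
       X \<in> (\<Pi> i\<in>{1..R}. lc_fun CARD('p) fps_X (L i)) \<longrightarrow>
       (\<exists>\<Delta> Ms w0 \<theta>0 r s.
          (\<forall>i\<in>{1..R}. 1 \<le> \<Delta> i \<and> 1 < Ms i) \<and>
          w0 \<in> (\<Pi> i\<in>{1..R}. lc_fun2 CARD('p) fps_X (L i + \<Delta> i)) \<and>
          \<theta>0 \<in> (\<Pi> i\<in>{1..R}. lc_fun CARD('p) fps_X (L i + \<Delta> i)) \<and>
          0 < r \<and> 0 < s \<and>
          (\<forall>w \<in> direct_sum_ball R (\<lambda>i. lc_fun2 CARD('p) fps_X (L i + \<Delta> i)) w0 r.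
           \<forall>\<theta> \<in> direct_sum_ball R (\<lambda>i. lc_fun CARD('p) fps_X (L i + \<Delta> i)) \<theta>0 s.
             let Y = dnn_product_output CARD('p) fps_X (\<lambda>i t. Ms i * \<sigma> t) L \<Delta> w \<theta> X
             in Y \<in> (\<Pi> i\<in>{1..R}. lc_fun CARD('p) fps_X (L i + \<Delta> i)) \<and>
                Lp_norm_tuple R \<rho> \<mu> (\<lambda>i x. Y i x - f i x) < ennreal \<epsilon>)))"
proof (intro conjI allI impI, goal_cases)
  have "isCont \<sigma> t" for t
    using assms(2) by (rule differentiable_imp_continuous_within)
  note approx = assms(1) this assms(3,4,6)
  {
    case (1 \<mu> f X)
    show ?case
      by (rule padic.dnn_product_approx_Lp[OF approx 1(1,2,4,5)])
  next
    case (2 \<mu> f X)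
    show ?case
      by (rule power_series.dnn_product_approx_Lp[OF approx 2(1,2,4,5)])
  }
qed

end
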